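(* Let $A(0),A(1),A(2)$ be the three $7\times7$ matrices given in the context. The set of sequences $\omega=\omega_1\omega_2\cdots\in\{0,1,2\}^{\mathbb{N}}$ which are $\mathbf{(C)}$-regular, i.e. such that $\mathcal{A}(\omega)=(A(\omega_1),A(\omega_2),\dots)$ satisfies condition $\mathbf{(C)}$, is the dense set $$\mathbf{X}:=\left(\{0,1,2\}^{\mathbb{N}}\setminus\bigcup_{n=0}^{+\infty}\sigma^{-n}\{\bar0\}\right)\cap\left(\{0,1,2\}^{\mathbb{N}}\setminus\bigcup_{n=0}^{+\infty}\sigma^{-n}\{\bar2\}\right),$$ where $\sigma$ is the shift map on $\{0,1,2\}^{\mathbb{N}}$, $\bar0=000\cdots$ and $\bar2=222\cdots$.
   Context: $$A(0)=\begin{pmatrix}1&0&0&0&0&0&0\\0&0&1&0&0&0&0\\0&0&0&1&1&0&0\\0&0&0&0&0&0&0\\1&0&0&0&0&0&1\\0&0&0&0&1&0&0\\0&1&0&0&0&0&0\end{pmatrix},\quad A(1)=\begin{pmatrix}0&0&1&1&0&0&0\\0&0&0&0&0&1&0\\0&0&0&1&1&0&0\\1&0&0&0&0&0&0\\0&0&1&0&0&0&0\\0&0&0&0&0&0&0\\0&0&0&0&0&0&0\end{pmatrix},\quad A(2)=\begin{pmatrix}1&0&0&0&1&0&1\\0&0&0&0&0&0&0\\1&0&0&0&0&0&1\\0&0&0&1&1&0&0\\0&0&0&0&1&0&0\\0&0&0&0&0&0&0\\0&0&0&0&0&0&0\end{pmatrix}.$$ $U_1,\dots,U_d$ are the canonical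 column vectors of $\mathbb{R}^d$ (here $d=7$), $\|\cdot\|$ is the sum of the moduli of the entries. For a column vector $V$, $\Delta(V):=\sum_{i:\,V(i)\ne0}U_i$; inequalities between vectors are entrywise. For a nonnegative matrix $A$ and reals $\lambda\ge0$, $\Lambda\ge1$: $A\in\mathcal{H}_1$ iff for all $j_0,j_1$, $\Delta(AU_{j_0})\ge\Delta(AU_{j_1})$ or $\Delta(AU_{j_0})\le\Delta(AU_{j_1})$; $A\in\mathcal{H}_2(\Lambda)$ iff for all $i_0,j_0$, $A(i_0,j_0)\ne0\Rightarrow\|AU_{j_0}\|\le\Lambda A(i_0,j_0)$; $A\in\mathcal{H}_3(\lambda)$ iff for all $i_0,j_0,j_1$, $[A(i_0,j_0)\ne0$ and $A(i_0,j_1)=0]\Rightarrow\|AU_{j_1}\|\le\lambda A(i_0,j_0)$. Condition $\mathbf{(C)}$. Given a sequence $(A_1,A_2,\dots)$ of nonnegative $d\times d$ matrices and integers $0=s_0=s_1<s_2<\cdots$, for $n\ge0$ let $k\ge0$ be the integer with $s_{k+1}\le n<s_{k+2}$ and put $Q_n:=A_{s_k+1}\cdots A_n$ ($Q_0$ is the identity). The sequence satisfies condition $\mathbf{(C)}$ if there exist $0\le\lambda<1\le\Lambda<+\infty$ and such integers $(s_0,s_1,\dots)$ for which $Q_n\in\mathcal{H}_1\cap\mathcal{H}_2(\Lambda)\cap\mathcal{H}_3(\lambda)$ for every $n\ge s_2$. *)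

theory Defs
  imports "HOL-Analysis.Analysis"
begin

section \<open>Condition (C)\<close>

definition norm1 :: "real ^ 'n \<Rightarrow> real" where
  "norm1 V = (\<Sum>i\<in>UNIV. \<bar>V $ i\<bar>)"

abbreviation unit_vec :: "'n \<Rightarrow> real ^ 'n" where
  "unit_vec j \<equiv> axis j 1"

definition supp_vec :: "real ^ 'n \<Rightarrow> real ^ 'n" (\<open>\<Delta>\<close>) where
  "\<Delta> V = (\<Sum>i | V $ i \<noteq> 0. unit_vec i)"

definition nonneg_mat :: "real ^ 'n ^ 'n \<Rightarrow> bool" where
  "nonneg_mat M \<longleftrightarrow> (\<forall>i j. 0 \<le> M $ i $ j)"

text \<open>The order on \<^typ>\<open>real ^ 'n\<close> is entrywise (\<open>less_eq_vec_def\<close>).\<close>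

definition H1 :: "(real ^ 'n ^ 'n) set" where
  "H1 = {M. nonneg_mat M \<and>
     (\<forall>j0 j1. \<Delta> (M *v unit_vec j0) \<ge> \<Delta> (M *v unit_vec j1) \<or>
              \<Delta> (M *v unit_vec j0) \<le> \<Delta> (M *v unit_vec j1))}"

definition H2 :: "real \<Rightarrow> (real ^ 'n ^ 'n) set" where
  "H2 \<Lambda> = {M. nonneg_mat M \<and>
     (\<forall>i0 j0. M $ i0 $ j0 \<noteq> 0 \<longrightarrow> norm1 (M *v unit_vec j0) \<le> \<Lambda> * M $ i0 $ j0)}"

definition H3 :: "real \<Rightarrow> (real ^ 'n ^ 'n) set" where
  "H3 lam = {M. nonneg_mat M \<and>
     (\<forall>i0 j0 j1. M $ i0 $ j0 \<noteq> 0 \<and> M $ i0 $ j1 = 0 \<longrightarrow>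
        norm1 (M *v unit_vec j1) \<le> lam * M $ i0 $ j0)}"

text \<open>
  Sequences are indexed from 0: \<open>S k\<close> is the matrix written \<open>A\<^sub>k\<^sub>+\<^sub>1\<close> when indexing starts at 1.
  Hence \<open>mat_prod S m n\<close> is \<open>A\<^sub>m\<^sub>+\<^sub>1 \<cdots> A\<^sub>n\<close>, which is the identity when \<open>n \<le> m\<close>.
\<close>

definition mat_prod :: "(nat \<Rightarrow> real ^ 'n ^ 'n) \<Rightarrow> nat \<Rightarrow> nat \<Rightarrow> real ^ 'n ^ 'n" where
  "mat_prod S m n = foldr (\<lambda>i M. S i ** M) [m..<n] (mat 1)"

definition cut_points :: "(nat \<Rightarrow> nat) \<Rightarrow> bool" where
  "cut_points s \<longleftrightarrow> s 0 = 0 \<and> s 1 = 0 \<and> (\<forall>k\<ge>1. s k < s (k + 1))"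

text \<open>\<open>block_index s n\<close> is well defined for all \<open>n\<close> when \<open>cut_points s\<close> holds.\<close>

definition block_index :: "(nat \<Rightarrow> nat) \<Rightarrow> nat \<Rightarrow> nat" where
  "block_index s n = (THE k. s (k + 1) \<le> n \<and> n < s (k + 2))"

definition Q :: "(nat \<Rightarrow> real ^ 'n ^ 'n) \<Rightarrow> (nat \<Rightarrow> nat) \<Rightarrow> nat \<Rightarrow> real ^ 'n ^ 'n" where
  "Q S s n = mat_prod S (s (block_index s n)) n"

definition condition_C :: "(nat \<Rightarrow> real ^ 'n ^ 'n) \<Rightarrow> bool" where
  "condition_C S \<longleftrightarrow> (\<forall>k. nonneg_mat (S k)) \<and>
     (\<exists>lam \<Lambda> s. 0 \<le> lam \<and> lam < 1 \<and> 1 \<le> \<Lambda> \<and> cut_points s \<and>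
        (\<forall>n \<ge> s 2. Q S s n \<in> H1 \<inter> H2 \<Lambda> \<inter> H3 lam))"

section \<open>The three matrices\<close>

text \<open>
  In \<^typ>\<open>7\<close> the numeral 7 equals 0; \<^const>\<open>vector\<close> fills the positions 1, ..., 7 in order.
  Letters other than 0, 1, 2 never occur in a word; their matrix is irrelevant.
\<close>

definition A :: "nat \<Rightarrow> real ^ 7 ^ 7" where
  "A a =
    (if a = 0 then vector
      [vector [1, 0, 0, 0, 0, 0, 0],
       vector [0, 0, 1, 0, 0, 0, 0],
       vector [0, 0, 0, 1, 1, 0, 0],
       vector [0, 0, 0, 0, 0, 0, 0],
       vector [1, 0, 0, 0, 0, 0, 1],
       vector [0, 0, 0, 0, 1, 0, 0],
       vector [0, 1, 0, 0, 0, 0, 0]]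
     else if a = 1 then vector
      [vector [0, 0, 1, 1, 0, 0, 0],
       vector [0, 0, 0, 0, 0, 1, 0],
       vector [0, 0, 0, 1, 1, 0, 0],
       vector [1, 0, 0, 0, 0, 0, 0],
       vector [0, 0, 1, 0, 0, 0, 0],
       vector [0, 0, 0, 0, 0, 0, 0],
       vector [0, 0, 0, 0, 0, 0, 0]]
     else if a = 2 then vector
      [vector [1, 0, 0, 0, 1, 0, 1],
       vector [0, 0, 0, 0, 0, 0, 0],
       vector [1, 0, 0, 0, 0, 0, 1],
       vector [0, 0, 0, 1, 1, 0, 0],
       vector [0, 0, 0, 0, 1, 0, 0],
       vector [0, 0, 0, 0, 0, 0, 0],
       vector [0, 0, 0, 0, 0, 0, 0]]
     else 0)"

section \<open>Words\<close>

text \<open>A word \<open>\<omega>\<^sub>1\<omega>\<^sub>2\<cdots>\<close> is the function \<open>\<omega>\<close> on \<^typ>\<open>nat\<close> with \<open>\<omega> k\<close> the letter \<open>\<omega>\<^sub>k\<^sub>+\<^sub>1\<close>.\<close>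

definition words :: "(nat \<Rightarrow> nat) set" where
  "words = {\<omega>. \<forall>k. \<omega> k \<in> {0, 1, 2}}"

definition word_topology :: "(nat \<Rightarrow> nat) topology" where
  "word_topology = product_topology (\<lambda>_. discrete_topology {0, 1, 2}) UNIV"

lemma topspace_word_topology: "topspace word_topology = words"
  by (simp add: word_topology_def words_def PiE_UNIV_domain Pi_def)

definition shift :: "(nat \<Rightarrow> nat) \<Rightarrow> (nat \<Rightarrow> nat)" where
  "shift \<omega> = (\<lambda>k. \<omega> (k + 1))"

definition const_word :: "nat \<Rightarrow> (nat \<Rightarrow> nat)" where
  "const_word a = (\<lambda>_. a)"

definition C_regular :: "(nat \<Rightarrow> nat) \<Rightarrow> bool" where
  "C_regular \<omega> \<longleftrightarrow> condition_C (\<lambda>k. A (\<omega> k))"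

definition X :: "(nat \<Rightarrow> nat) set" where
  "X = (words - (\<Union>n. (shift ^^ n) -` {const_word 0})) \<inter>
       (words - (\<Union>n. (shift ^^ n) -` {const_word 2}))"

end

theory Submission
  imports Defs
begin

text \<open>
  For a word that is eventually 0 or eventually 2, all matrices \<open>Q\<^sub>n\<close> from some point on are
  powers of one matrix. In a power of \<open>A 0\<close> the columns 2, 3, 5, 7 restricted to the rows 2, 3, 5, 7
  form a permutation matrix, and a power of \<open>A 2\<close> has the identity matrix in the rows and columns 1, 4;
  so two columns have incomparable supports and \<open>H1\<close> fails, whatever the cut points are.

  Conversely, let a word have infinitely many letters other than 0 and infinitely many other than 2.
  Since runs of 0 or 2 may be arbitrarily long, a finite set of blocks is not enough; each block begins
  with one of finitely many words and is followed through arbitrary continuations.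
  The idea is to begin a block with a word \<open>z\<close> for which the row supports of the product of \<open>z\<close>
  take only the values \<open>{}\<close>, \<open>B\<close> and \<open>B \<union> L\<close>, with \<open>B\<close> and \<open>L\<close> disjoint. Multiplying on the
  left by any nonnegative matrix keeps this. Multiplying on the right by a product \<open>U\<close> then gives
  rows that are, up to constants depending on the starting matrix only, \<open>0\<close>, \<open>\<beta>\<close> or \<open>\<beta> + \<alpha>\<close>, where
  \<open>\<alpha>\<close> and \<open>\<beta>\<close> are the indicator vectors of \<open>L\<close> and \<open>B\<close> times \<open>U\<close>. The column supports are
  therefore nested, which is \<open>H1\<close>; \<open>H2\<close> follows from a bound of \<open>\<alpha>\<close> by a multiple of \<open>\<beta>\<close> in the
  columns where \<open>\<beta>\<close> is positive, and \<open>H3\<close> holds as soon as the positive entries of \<open>\<beta>\<close> are large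
  compared with the entries of \<open>\<alpha>\<close> in the columns where \<open>\<beta>\<close> vanishes (\<open>two_level_mem_H\<close>).

  The pair \<open>(\<alpha>, \<beta>)\<close> is controlled by a finite automaton (\<open>states\<close>). A state says for each column
  whether both vectors vanish there, or \<open>\<beta>\<close> vanishes and \<open>\<alpha>\<close> is exactly 1, or \<open>\<beta>\<close> is positive;
  in the last case it carries two numbers. The offset \<open>h\<close> sharpens \<open>\<alpha> \<le> 3 * \<beta>\<close> to \<open>\<alpha> + h \<le> 3 * \<beta>\<close>,
  which survives the columns where units of \<open>\<alpha>\<close> are added. The rank proves that \<open>\<beta>\<close> tends to infinity:
  an entry of \<open>\<beta>\<close> either is a sum of two positive entries, hence larger than the old
  minimum by at least 1, or is a copy of one old entry; along copies the rank cannot increase, and it can stay constant only while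
  the letter read is the one loop letter, 0 or 2, attached to that rank. A minimum that stopped growing
  would therefore force the word to be eventually 0 or eventually 2 (\<open>big_cells_grow\<close>). A pair can
  also leave the automaton, but then one of the two levels has disappeared and what remains to be
  shown is preserved trivially (\<open>flat\<close>).

  Finally, 27 words \<open>z\<close> suffice: around an occurrence of 20 or 21, or of 10 in a word
  over \<open>{0, 1}\<close>, or in a run of 1s, one of them always occurs (\<open>start_word_occurs\<close>). One \<open>z\<close>
  occurs infinitely often, so that its occurrences serve as cut points with common constants.
  The first block has to begin at position 0; the letters before the first occurrence of \<open>z\<close> change
  its constants only.
\<close>

section \<open>Products of the matrices along a word\<close>

definition word_prod :: "nat list \<Rightarrow> real ^ 7 ^ 7" where
  "word_prod u = foldr (\<lambda>a M. A a ** M) u (mat 1)"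

lemma word_prod_Nil [simp]: "word_prod [] = mat 1"
  by (simp add: word_prod_def)

lemma word_prod_append: "word_prod (u @ v) = word_prod u ** word_prod v"
  by (induction u) (simp_all add: word_prod_def matrix_mul_assoc)

lemma word_prod_snoc: "word_prod (u @ [a]) = word_prod u ** A a"
  by (simp add: word_prod_append) (simp add: word_prod_def)

lemma mat_prod_eq_word_prod:
  "mat_prod (\<lambda>k. A (\<omega> k)) m n = word_prod (map \<omega> [m..<n])"
  by (simp add: mat_prod_def word_prod_def foldr_map comp_def)

text \<open>
  The rows in which column \<open>k\<close> of \<open>A a\<close> has the entry 1, all other entries of that column being 0.
  All computations with the three matrices below go through these lists: column \<open>k\<close> of \<open>M ** A a\<close> is the
  sum of the columns of \<open>M\<close> with indices in \<open>preds a k\<close>. Columns are numbered from 1 to 7.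
\<close>

definition preds :: "nat \<Rightarrow> nat \<Rightarrow> nat list" where
  "preds a k =
    (if a = 0 then [[1, 5], [7], [2], [3], [3, 6], [], [5]]
     else if a = 1 then [[4], [], [1, 5], [1, 3], [3], [2], []]
     else [[1, 3], [], [], [4], [1, 4, 5], [], [1, 3]]) ! (k - 1)"

lemma UNIV_7: "(UNIV :: 7 set) = {1, 2, 3, 4, 5, 6, 7}"
proof -
  have "card {1, 2, 3, 4, 5, 6, 7 :: 7} = card (UNIV :: 7 set)"
    by simp
  then show ?thesis
    by (intro card_subset_eq [symmetric]) (auto simp only: finite subset_UNIV)
qed

lemma atLeastAtMost_1_7: "{1..7 :: nat} = {1, 2, 3, 4, 5, 6, 7}"
  by auto

lemma index_7_cases:
  obtains k where "k \<in> {1..7}" "(j :: 7) = of_nat k"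
proof -
  have "j \<in> {1, 2, 3, 4, 5, 6, 7}"
    using UNIV_7 by blast
  then show ?thesis
    using that[of 1] that[of 2] that[of 3] that[of 4] that[of 5] that[of 6] that[of 7] by auto
qed

lemma of_nat_7_eq_iff:
  assumes "i \<in> {1..7}" "k \<in> {1..7}"
  shows "of_nat i = (of_nat k :: 7) \<longleftrightarrow> i = k"
  using assms unfolding atLeastAtMost_1_7 by auto

lemma sum_7: "(\<Sum>i\<in>(UNIV :: 7 set). f i) = f 1 + f 2 + f 3 + f 4 + f 5 + f 6 + (f 7 :: real)"
  unfolding UNIV_7 by simp

lemma vector_7:
  "(vector [x1, x2, x3, x4, x5, x6, x7] :: 'a::zero ^ 7) $ 1 = x1"
  "(vector [x1, x2, x3, x4, x5, x6, x7] :: 'a ^ 7) $ 2 = x2"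
  "(vector [x1, x2, x3, x4, x5, x6, x7] :: 'a ^ 7) $ 3 = x3"
  "(vector [x1, x2, x3, x4, x5, x6, x7] :: 'a ^ 7) $ 4 = x4"
  "(vector [x1, x2, x3, x4, x5, x6, x7] :: 'a ^ 7) $ 5 = x5"
  "(vector [x1, x2, x3, x4, x5, x6, x7] :: 'a ^ 7) $ 6 = x6"
  "(vector [x1, x2, x3, x4, x5, x6, x7] :: 'a ^ 7) $ 7 = x7"
  unfolding vector_def by simp_all

lemma vec_mult_A:
  assumes a: "a \<in> {0, 1, 2}" and k: "k \<in> {1..7}"
  shows "(x v* A a) $ of_nat k = (\<Sum>i\<leftarrow>preds a k. x $ of_nat i)"
proof -
  have c: "a = 0 \<or> a = 1 \<or> a = 2"
    using a by blast
  from k have "k = 1 \<or> k = 2 \<or> k = 3 \<or> k = 4 \<or> k = 5 \<or> k = 6 \<or> k = 7"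
    unfolding atLeastAtMost_1_7 by blast
  then show ?thesis
    using c
    by (elim disjE)
      (simp_all only: vector_matrix_mult_def sum_7 vec_lambda_beta,
       simp_all add: A_def vector_7 preds_def del: One_nat_def)
qed

lemma nonneg_A: "nonneg_mat (A a)"
proof -
  have "0 \<le> A a $ i $ j" for i j
  proof -
    obtain k where "k \<in> {1..7}" "i = of_nat k" by (rule index_7_cases)
    moreover obtain l where "l \<in> {1..7}" "j = of_nat l" by (rule index_7_cases)
    ultimately show ?thesis
      unfolding atLeastAtMost_1_7
      by (elim insertE emptyE) (simp_all add: A_def vector_7 del: One_nat_def)
  qed
  then show ?thesis
    by (simp add: nonneg_mat_def)
qed

section \<open>Words that are eventually 0 or 2\<close>

lemma supp_vec_nth: "\<Delta> V $ i = (if V $ i = 0 then 0 else 1)"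
  by (simp add: supp_vec_def axis_def sum.delta if_distrib cong: if_cong)

lemma supp_vec_le_iff: "\<Delta> V \<le> \<Delta> W \<longleftrightarrow> (\<forall>i. W $ i = 0 \<longrightarrow> V $ i = 0)"
  by (auto simp: less_eq_vec_def supp_vec_nth)

lemma mult_unit_vec: "(M *v unit_vec j) $ i = M $ i $ j"
  by (simp add: matrix_vector_mult_basis column_def)

lemma not_H1_I:
  assumes "M $ i $ j \<noteq> 0" "M $ i $ j' = 0" "M $ i' $ j = 0" "M $ i' $ j' \<noteq> 0"
  shows "M \<notin> H1"
  using assms unfolding H1_def supp_vec_le_iff mult_unit_vec by blast

lemma mult_A_nth:
  assumes "a \<in> {0, 1, 2}" "k \<in> {1..7}"
  shows "(M ** A a) $ i $ of_nat k = (\<Sum>l\<leftarrow>preds a k. M $ i $ of_nat l)"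
proof -
  have "(M ** A a) $ i = M $ i v* A a"
    by (simp add: matrix_matrix_mult_def vector_matrix_mult_def vec_eq_iff mult.commute)
  then show ?thesis
    using vec_mult_A [OF assms, of "M $ i"] by simp
qed

lemma mult_A0_nth:
  "(M ** A 0) $ i $ 2 = M $ i $ 7" "(M ** A 0) $ i $ 3 = M $ i $ 2"
  "(M ** A 0) $ i $ 5 = M $ i $ 3 + M $ i $ 6" "(M ** A 0) $ i $ 6 = 0"
  "(M ** A 0) $ i $ 7 = M $ i $ 5"
  using mult_A_nth [of 0 2 M i] mult_A_nth [of 0 3 M i] mult_A_nth [of 0 5 M i]
    mult_A_nth [of 0 6 M i] mult_A_nth [of 0 7 M i]
  by (simp_all add: preds_def)

lemma mult_A2_nth:
  "(M ** A 2) $ i $ 1 = M $ i $ 1 + M $ i $ 3" "(M ** A 2) $ i $ 3 = 0"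
  "(M ** A 2) $ i $ 4 = M $ i $ 4"
  using mult_A_nth [of 2 1 M i] mult_A_nth [of 2 3 M i] mult_A_nth [of 2 4 M i]
  by (simp_all add: preds_def)

lemma mat_1_nth: "(mat 1 :: real ^ 7 ^ 7) $ i $ j = (if i = j then 1 else 0)"
  by (simp add: mat_def)

lemma word_prod_replicate_Suc:
  "word_prod (replicate (Suc m) a) = word_prod (replicate m a) ** A a"
  by (metis replicate_append_same replicate_Suc word_prod_snoc)

text \<open>
  Right multiplication by \<open>A 0\<close> moves the columns 7, 2, 3, 5 to 2, 3, 5, 7; column 6 is added to one of
  them but lives in row 6 only. Seen in the rows 2, 3, 5, 7, these columns are thus permuted cyclically,
  and they stay distinct unit vectors.
\<close>

lemma power_A0_not_H1: "word_prod (replicate m 0) \<notin> H1"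
proof -
  let ?M = "\<lambda>m. word_prod (replicate m 0)"
  define row where "row m i = [?M m $ i $ 2, ?M m $ i $ 3, ?M m $ i $ 5, ?M m $ i $ 7]" for m i
  have shift: "row (Suc m) i = [?M m $ i $ 7, ?M m $ i $ 2, ?M m $ i $ 3 + ?M m $ i $ 6, ?M m $ i $ 5]"
    for m i
    unfolding row_def word_prod_replicate_Suc mult_A0_nth ..
  have six: "?M m $ i $ 6 = 0" if "i \<noteq> 6" for m i
  proof (cases m)
    case 0
    with that show ?thesis by (simp add: mat_1_nth)
  next
    case (Suc m')
    then show ?thesis
      by (simp only: word_prod_replicate_Suc mult_A0_nth)
  qed
  have "(row m 2, row m 3, row m 5, row m 7) \<in>
    {([1,0,0,0], [0,1,0,0], [0,0,1,0], [0,0,0,1]),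
     ([0,1,0,0], [0,0,1,0], [0,0,0,1], [1,0,0,0]),
     ([0,0,1,0], [0,0,0,1], [1,0,0,0], [0,1,0,0]),
     ([0,0,0,1], [1,0,0,0], [0,1,0,0], [0,0,1,0])}"
  proof (induction m)
    case 0
    then show ?case by (simp add: row_def mat_1_nth)
  next
    case (Suc m)
    have "row (Suc m) i = [row m i ! 3, row m i ! 0, row m i ! 1, row m i ! 2]"
      if "i \<noteq> 6" for i
      using six [OF that] by (simp add: shift) (simp add: row_def)
    with Suc show ?case by (elim insertE emptyE) simp_all
  qed
  then consider
      "row m 2 = [1,0,0,0]" "row m 3 = [0,1,0,0]" | "row m 2 = [0,1,0,0]" "row m 7 = [1,0,0,0]"
    | "row m 7 = [0,1,0,0]" "row m 5 = [1,0,0,0]" | "row m 3 = [1,0,0,0]" "row m 5 = [0,1,0,0]"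
    by (elim insertE emptyE) simp_all
  then show ?thesis
    unfolding row_def list.inject
  proof cases
    case 1
    then show ?thesis by (intro not_H1_I [where i = 2 and i' = 3 and j = 2 and j' = 3]) simp_all
  next
    case 2
    then show ?thesis by (intro not_H1_I [where i = 2 and i' = 7 and j = 3 and j' = 2]) simp_all
  next
    case 3
    then show ?thesis by (intro not_H1_I [where i = 7 and i' = 5 and j = 3 and j' = 2]) simp_all
  next
    case 4
    then show ?thesis by (intro not_H1_I [where i = 3 and i' = 5 and j = 2 and j' = 3]) simp_all
  qed
qed

lemma power_A2_not_H1: "word_prod (replicate m 2) \<notin> H1"
proof -
  let ?M = "\<lambda>m. word_prod (replicate m 2)"
  have "?M m $ 1 $ 1 = 1 \<and> ?M m $ 1 $ 3 = 0 \<and> ?M m $ 1 $ 4 = 0 \<and>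
    ?M m $ 4 $ 1 = 0 \<and> ?M m $ 4 $ 3 = 0 \<and> ?M m $ 4 $ 4 = 1"
  proof (induction m)
    case 0
    then show ?case by (simp add: mat_1_nth)
  next
    case (Suc m)
    then show ?case by (simp add: word_prod_replicate_Suc mult_A2_nth del: replicate.simps)
  qed
  then show ?thesis
    by (intro not_H1_I [where i = 1 and j = 1 and i' = 4 and j' = 4]) auto
qed

lemma cut_points_strict_mono:
  assumes "cut_points s" "1 \<le> i" "i < j"
  shows "s i < s j"
proof -
  have "s k < s (Suc k)" if "k \<ge> 1" for k
    using assms(1) that by (simp add: cut_points_def)
  moreover obtain d where "j = Suc (i + d)"
    using assms(3) less_imp_Suc_add by blast
  moreover have "s i < s (Suc (i + d))" for d
  proof (induction d)
    case 0
    then show ?case using calculation(1) [of i] assms(2) by simp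
  next
    case (Suc d)
    then show ?case using calculation(1) [of "Suc (i + d)"] by simp
  qed
  ultimately show ?thesis by blast
qed

lemma cut_points_ge:
  assumes "cut_points s" shows "k \<le> s (Suc k)"
proof (induction k)
  case (Suc k)
  have "s (Suc k) < s (Suc (Suc k))"
    using assms by (simp add: cut_points_def)
  with Suc show ?case by linarith
qed simp

lemma block_index_eq:
  assumes s: "cut_points s" and n: "s (k + 1) \<le> n" "n < s (k + 2)"
  shows "block_index s n = k"
  unfolding block_index_def
proof (rule the_equality)
  show "s (k + 1) \<le> n \<and> n < s (k + 2)"
    using n by blast
next
  fix l assume l: "s (l + 1) \<le> n \<and> n < s (l + 2)"
  have mono: "s i \<le> s j" if "1 \<le> i" "i \<le> j" for i j
    using cut_points_strict_mono [OF s, of i j] that by (cases "i = j") auto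
  show "l = k"
  proof (cases l k rule: linorder_cases)
    case less
    then show ?thesis using mono [of "l + 2" "k + 1"] l n by simp
  next
    case greater
    then show ?thesis using mono [of "k + 2" "l + 1"] l n by simp
  qed
qed

text \<open>
  The cut points tend to infinity, so some \<open>Q\<^sub>n\<close> is a power of \<open>A 0\<close> or of \<open>A 2\<close>.
\<close>

lemma not_C_regular_if_eventually_const:
  assumes const: "\<And>k. k \<ge> N \<Longrightarrow> \<omega> k = a" and a: "a = 0 \<or> a = 2"
  shows "\<not> C_regular \<omega>"
proof
  assume "C_regular \<omega>"
  then obtain lam L s where s: "cut_points s"
    and Q: "\<And>n. n \<ge> s 2 \<Longrightarrow> Q (\<lambda>k. A (\<omega> k)) s n \<in> H1 \<inter> H2 L \<inter> H3 lam"
    unfolding C_regular_def condition_C_def by blast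
  define k where "k = N + 1"
  have less: "s (k + 1) < s (k + 2)"
    using cut_points_strict_mono [OF s, of "k + 1" "k + 2"] by simp
  have "s 2 \<le> s (k + 1)"
    using cut_points_strict_mono [OF s, of 2 "k + 1"] by (cases "k = 1") (auto simp: k_def numeral_2_eq_2)
  from Q [OF this] have "mat_prod (\<lambda>k. A (\<omega> k)) (s k) (s (k + 1)) \<in> H1"
    using block_index_eq [OF s order_refl less] by (simp add: Q_def)
  moreover have "map \<omega> [s k..<s (k + 1)] = replicate (s (k + 1) - s k) a"
  proof (rule nth_equalityI)
    fix i assume i: "i < length (map \<omega> [s k..<s (k + 1)])"
    have "N \<le> s k"
      using cut_points_ge [OF s, of N] by (simp add: k_def)
    with i show "map \<omega> [s k..<s (k + 1)] ! i = replicate (s (k + 1) - s k) a ! i"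
      by (simp add: const)
  qed simp
  ultimately show False
    using a power_A0_not_H1 power_A2_not_H1 by (auto simp: mat_prod_eq_word_prod)
qed

section \<open>A criterion for condition (C)\<close>

lemma H2_mono: "L \<le> L' \<Longrightarrow> M \<in> H2 L \<Longrightarrow> M \<in> H2 L'"
  unfolding H2_def nonneg_mat_def by (blast intro: order_trans mult_right_mono)

text \<open>
  Cut points are chosen greedily among the good starting points: each one is taken so late that the
  block begun at the previous one has already become good, because \<open>Q\<^sub>n\<close> starts at the last cut point but
  one. The first block may have a constant of its own, since it is only one block.
\<close>

lemma condition_C_I:
  fixes S :: "nat \<Rightarrow> real ^ 'n ^ 'n"
  assumes nonneg: "\<And>k. nonneg_mat (S k)"
    and lam: "0 \<le> lam" "lam < 1"
    and initial: "\<exists>q. \<forall>n\<ge>q. mat_prod S 0 n \<in> H1 \<inter> H2 L0 \<inter> H3 lam"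
    and later: "\<And>N. \<exists>p\<ge>N. \<exists>q. \<forall>n\<ge>q. mat_prod S p n \<in> H1 \<inter> H2 L1 \<inter> H3 lam"
  shows "condition_C S"
proof -
  define L where "L = max 1 (max L0 L1)"
  define G where "G p n \<longleftrightarrow> mat_prod S p n \<in> H1 \<inter> H2 L \<inter> H3 lam" for p n
  have L0: "M \<in> H2 L0 \<Longrightarrow> M \<in> H2 L" and L1: "M \<in> H2 L1 \<Longrightarrow> M \<in> H2 L" for M :: "real ^ 'n ^ 'n"
    by (auto simp: L_def elim!: H2_mono [rotated])
  have "\<exists>t. \<forall>k. ((k = 0 \<longrightarrow> t k = 0) \<and> (\<exists>q. \<forall>n\<ge>q. G (t k) n)) \<and>
      (t k < t (Suc k) \<and> (\<forall>n\<ge>t (Suc k). G (t k) n))"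
    proof (rule dependent_nat_choice)
      show "\<exists>x. (0 = 0 \<longrightarrow> x = 0) \<and> (\<exists>q. \<forall>n\<ge>q. G x n)"
        using initial L0 by (auto simp: G_def)
    next
      fix x k :: nat assume "(k = 0 \<longrightarrow> x = 0) \<and> (\<exists>q. \<forall>n\<ge>q. G x n)"
      then obtain q where q: "\<And>n. n \<ge> q \<Longrightarrow> G x n" by blast
      obtain p q' where p: "p \<ge> max q (Suc x)" and
        "\<forall>n\<ge>q'. mat_prod S p n \<in> H1 \<inter> H2 L1 \<inter> H3 lam"
        using later [of "max q (Suc x)"] by blast
      then have p': "\<forall>n\<ge>q'. G p n"
        by (simp add: G_def L1)
      show "\<exists>y. ((Suc k = 0 \<longrightarrow> y = 0) \<and> (\<exists>q. \<forall>n\<ge>q. G y n)) \<and>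
          x < y \<and> (\<forall>n\<ge>y. G x n)"
      proof (rule exI [of _ p], intro conjI allI impI)
        show "\<exists>q. \<forall>n\<ge>q. G p n"
          using p' by blast
        show "x < p"
          using p by simp
        show "G x n" if "p \<le> n" for n
          using p q that by simp
      qed simp
    qed
  then obtain t where t: "\<And>k. ((k = 0 \<longrightarrow> t k = 0) \<and> (\<exists>q. \<forall>n\<ge>q. G (t k) n)) \<and>
      (t k < t (Suc k) \<and> (\<forall>n\<ge>t (Suc k). G (t k) n))"
    by (auto simp only:)
  have t0: "t 0 = 0" and t_less: "t k < t (Suc k)"
    and t_good: "n \<ge> t (Suc k) \<Longrightarrow> G (t k) n" for k n
    using t [of 0] t [of k] by simp_all
  \<comment> \<open>Truncated subtraction gives the required \<open>s 0 = s 1 = 0\<close>.\<close>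
  define s where "s k = t (k - 1)" for k
  have s: "cut_points s"
    unfolding cut_points_def s_def
  proof (intro conjI allI impI)
    show "t (k - 1) < t (k + 1 - 1)" if "1 \<le> k" for k
      using t_less [of "k - 1"] that by simp
  qed (simp_all add: t0)
  have "Q S s n \<in> H1 \<inter> H2 L \<inter> H3 lam" if n: "n \<ge> s 2" for n
  proof -
    have "strict_mono t"
      using t_less by (simp add: strict_mono_Suc_iff)
    then have ge: "k \<le> t k" for k
      by (rule strict_mono_imp_increasing)
    define l where "l = (LEAST l. n < t l)"
    have l: "n < t l"
      unfolding l_def by (rule LeastI [of _ "Suc n"]) (use ge [of "Suc n"] in simp)
    have "l > 1"
    proof (rule ccontr)
      assume "\<not> l > 1"
      then have "t l \<le> t 1"
        using \<open>strict_mono t\<close> by (simp add: strict_mono_less_eq)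
      with l n show False by (simp add: s_def)
    qed
    define k where "k = l - 1"
    have "\<not> n < t k"
      by (rule not_less_Least [of k "\<lambda>l. n < t l"]) (use \<open>l > 1\<close> in \<open>simp add: k_def flip: l_def\<close>)
    then have k: "t k \<le> n" "n < t (Suc k)" "k \<ge> 1"
      using l \<open>l > 1\<close> by (auto simp: k_def)
    then have "block_index s n = k"
      by (intro block_index_eq [OF s]) (auto simp: s_def)
    moreover have "G (t (k - 1)) n"
      using t_good [of "k - 1" n] k by simp
    ultimately show ?thesis
      by (simp add: Q_def G_def s_def)
  qed
  then have "0 \<le> lam \<and> lam < 1 \<and> 1 \<le> L \<and> cut_points s \<and>
      (\<forall>n\<ge>s 2. Q S s n \<in> H1 \<inter> H2 L \<inter> H3 lam)"
    using lam s by (simp add: L_def)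
  with nonneg show ?thesis
    unfolding condition_C_def by blast
qed

section \<open>Two-level matrices\<close>

text \<open>
  The rows of \<open>M\<close> take three shapes up to constants, so the norm of a column is at most a multiple of
  \<open>\<beta> + \<alpha>\<close> at that column, whereas its nonzero entries are bounded below by \<open>\<beta>\<close> where \<open>\<beta>\<close> is positive,
  and by \<open>\<alpha>\<close> elsewhere. In \<open>H3\<close> the second column must be one where \<open>\<beta>\<close> vanishes, so only there
  does \<open>\<alpha>\<close> have to be small.
\<close>

lemma two_level_mem_H:
  fixes M :: "real ^ 'n ^ 'n" and \<beta> \<alpha> :: "real ^ 'n"
  assumes c: "0 < c" and \<kappa>: "0 \<le> \<kappa>" and C: "0 \<le> C"
    and lam: "0 \<le> lam"
    and nonneg: "\<And>j. 0 \<le> \<beta> $ j" "\<And>j. 0 \<le> \<alpha> $ j"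
    and rows: "\<And>i. \<exists>t\<in>{0, \<beta>, \<beta> + \<alpha>}. \<forall>j. c * t $ j \<le> M $ i $ j \<and> M $ i $ j \<le> \<kappa> * t $ j"
    and ratio: "\<And>j. \<beta> $ j > 0 \<Longrightarrow> \<alpha> $ j \<le> C * \<beta> $ j"
    and small: "\<And>j j'. \<beta> $ j > 0 \<Longrightarrow> \<beta> $ j' = 0 \<Longrightarrow>
      real CARD('n) * \<kappa> * \<alpha> $ j' \<le> lam * (c * \<beta> $ j)"
  shows "M \<in> H1 \<inter> H2 (real CARD('n) * \<kappa> * (1 + C) / c) \<inter> H3 lam"
proof -
  obtain t where t: "\<And>i. t i \<in> {0, \<beta>, \<beta> + \<alpha>}"
    and lower: "\<And>i j. c * t i $ j \<le> M $ i $ j" and upper: "\<And>i j. M $ i $ j \<le> \<kappa> * t i $ j"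
    using rows by metis
  have t_cases: "t i = 0 \<or> t i = \<beta> \<or> t i = \<beta> + \<alpha>" for i
    using t [of i] by blast
  have t_nonneg: "0 \<le> t i $ j" for i j
    using t_cases [of i] nonneg(1) [of j] nonneg(2) [of j] by auto
  have M_nonneg: "0 \<le> M $ i $ j" for i j
    using order_trans [OF _ lower [of i j]] c t_nonneg [of i j] by simp
  have zero_iff: "M $ i $ j = 0 \<longleftrightarrow> t i $ j = 0" if "M $ i $ j = 0 \<or> t i $ j = 0" for i j
    using that lower [of i j] upper [of i j] t_nonneg [of i j] c M_nonneg [of i j]
    by (auto simp: mult_le_0_iff)
  have t_le: "t i $ j \<le> \<beta> $ j + \<alpha> $ j" for i j
    using t_cases [of i] nonneg(1) [of j] nonneg(2) [of j] by auto
  have norm: "norm1 (M *v unit_vec j) \<le> real CARD('n) * \<kappa> * (\<beta> $ j + \<alpha> $ j)" for j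
  proof -
    have "norm1 (M *v unit_vec j) = (\<Sum>i\<in>UNIV. M $ i $ j)"
      by (simp add: norm1_def mult_unit_vec M_nonneg)
    also have "\<dots> \<le> (\<Sum>i\<in>(UNIV :: 'n set). \<kappa> * (\<beta> $ j + \<alpha> $ j))"
      using order_trans [OF upper mult_left_mono [OF t_le \<kappa>]] by (intro sum_mono)
    finally show ?thesis by (simp add: mult.assoc)
  qed
  \<comment> \<open>The support of a column depends only on whether \<beta>, or else \<alpha>, is positive there.\<close>
  have supp_big: "M $ i $ j' = 0" if "\<beta> $ j > 0" "M $ i $ j = 0" for i j j'
    using that zero_iff [of i j] zero_iff [of i j'] t_cases [of i] nonneg(2) [of j] by auto
  have supp_small: "M $ i $ j' = 0" if "\<alpha> $ j > 0" "\<beta> $ j' = 0" "M $ i $ j = 0" for i j j'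
    using that zero_iff [of i j] zero_iff [of i j'] t_cases [of i] nonneg(1) [of j] by auto
  have supp_none: "M $ i $ j = 0" if "\<beta> $ j = 0" "\<alpha> $ j = 0" for i j
    using that zero_iff [of i j] t_cases [of i] by auto
  have H1: "M \<in> H1"
    unfolding H1_def supp_vec_le_iff mult_unit_vec mem_Collect_eq nonneg_mat_def
  proof (intro conjI allI)
    show "0 \<le> M $ i $ j" for i j
      by (rule M_nonneg)
    show "(\<forall>i. M $ i $ j = 0 \<longrightarrow> M $ i $ j' = 0) \<or> (\<forall>i. M $ i $ j' = 0 \<longrightarrow> M $ i $ j = 0)" for j j'
    proof -
      consider "\<beta> $ j > 0" | "\<beta> $ j' > 0" | "\<beta> $ j = 0" "\<beta> $ j' = 0" "\<alpha> $ j > 0"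
        | "\<beta> $ j = 0" "\<alpha> $ j = 0"
        using nonneg by (metis less_eq_real_def)
      then show ?thesis
        using supp_big supp_small supp_none by cases blast+
    qed
  qed
  have H2: "norm1 (M *v unit_vec j) \<le> real CARD('n) * \<kappa> * (1 + C) / c * M $ i $ j"
    if ne: "M $ i $ j \<noteq> 0" for i j
  proof -
    have "t i $ j \<noteq> 0"
      using ne zero_iff by blast
    then have "t i $ j = \<beta> $ j + \<alpha> $ j \<or> \<alpha> $ j \<le> C * \<beta> $ j \<and> t i $ j = \<beta> $ j"
      using t_cases [of i] ratio [of j] nonneg(1) [of j] by auto
    then have "\<beta> $ j + \<alpha> $ j \<le> (1 + C) * t i $ j"
      using nonneg(1) [of j] nonneg(2) [of j] C by (auto simp: distrib_left distrib_right)
    also have "\<dots> \<le> (1 + C) * (M $ i $ j / c)"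
      using lower [of i j] c C by (intro mult_left_mono) (auto simp: field_simps)
    finally have "real CARD('n) * \<kappa> * (\<beta> $ j + \<alpha> $ j) \<le>
        real CARD('n) * \<kappa> * ((1 + C) * (M $ i $ j / c))"
      using \<kappa> by (intro mult_left_mono) auto
    with norm [of j] show ?thesis by (simp add: mult.assoc)
  qed
  have H3: "norm1 (M *v unit_vec j') \<le> lam * M $ i $ j"
    if ne: "M $ i $ j \<noteq> 0" and z: "M $ i $ j' = 0" for i j j'
  proof -
    have \<beta>j': "\<beta> $ j' = 0"
      using supp_big [of j' i j] ne z nonneg(1) [of j'] by (auto simp: less_eq_real_def)
    show ?thesis
    proof (cases "\<beta> $ j > 0")
      case True
      have "norm1 (M *v unit_vec j') \<le> lam * (c * \<beta> $ j)"
        using norm [of j'] small [OF True \<beta>j'] \<beta>j' by simp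
      also have "c * \<beta> $ j \<le> M $ i $ j"
      proof -
        have "\<beta> $ j \<le> t i $ j"
          using zero_iff [of i j] ne t_cases [of i] nonneg(2) [of j] by auto
        then have "c * \<beta> $ j \<le> c * t i $ j"
          using c by simp
        also note lower [of i j]
        finally show ?thesis .
      qed
      finally show ?thesis
        using lam by (simp add: mult_left_mono)
    next
      case False
      have "\<alpha> $ j' = 0"
        using supp_small [of j' j i] ne z nonneg(1) [of j] nonneg(2) [of j'] False
        by (auto simp: less_eq_real_def)
      then show ?thesis
        using norm [of j'] \<beta>j' lam M_nonneg [of i j] by (simp add: order_trans)
    qed
  qed
  show ?thesis
    using H1 H2 H3 M_nonneg by (simp add: H2_def H3_def nonneg_mat_def)
qed

section \<open>A finite automaton for the two levels\<close>

text \<open>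
  The content of one column of the pair of rows \<open>(\<alpha>, \<beta>)\<close>: both entries vanish, or only \<open>\<beta>\<close> does, or
  \<open>\<beta>\<close> is positive. The arguments of \<open>Big\<close> are an offset and a rank: the offset strengthens the bound of
  \<open>\<alpha>\<close> by \<open>\<beta>\<close> so that it is inductive, and the rank is a termination measure for the growth of \<open>\<beta>\<close>.
\<close>

datatype cell = Zero | Small | Big nat nat

definition fits :: "cell \<Rightarrow> real \<Rightarrow> real \<Rightarrow> bool" where
  "fits c \<alpha> \<beta> =
    (case c of
       Zero \<Rightarrow> \<alpha> = 0 \<and> \<beta> = 0
     | Small \<Rightarrow> \<alpha> = 1 \<and> \<beta> = 0
     | Big h r \<Rightarrow> 1 \<le> \<beta> \<and> 0 \<le> \<alpha> \<and> \<alpha> + h \<le> 3 * \<beta>)"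

primrec is_Big :: "cell \<Rightarrow> bool" where
  "is_Big Zero = False"
| "is_Big Small = False"
| "is_Big (Big h r) = True"

primrec offset :: "cell \<Rightarrow> nat" where
  "offset Zero = 0"
| "offset Small = 0"
| "offset (Big h r) = h"

primrec rank :: "cell \<Rightarrow> nat" where
  "rank Zero = 0"
| "rank Small = 0"
| "rank (Big h r) = r"

definition smalls :: "cell list \<Rightarrow> nat" where
  "smalls cs = length (filter (\<lambda>c. c = Small) cs)"

definition bigs :: "cell list \<Rightarrow> cell list" where
  "bigs cs = filter is_Big cs"

text \<open>
  The only letter that can be read forever while an entry of \<open>\<beta>\<close> of rank \<open>r\<close> is copied without change of
  rank. The ranks are numbered such that their parity tells this letter.
\<close>

definition loop_letter :: "nat \<Rightarrow> nat" where
  "loop_letter r = (if even r then 0 else 2)"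

text \<open>
  The last argument soundly describes the sum of entries that are described by the cells in \<open>cs\<close>, when
  the letter \<open>a\<close> is read: a \<open>Small\<close> addend costs one unit of offset, and if only one addend is \<open>Big\<close>,
  then \<open>\<beta>\<close> is copied and the rank has to pay for it.
\<close>

primrec succ_cell :: "nat \<Rightarrow> cell list \<Rightarrow> cell \<Rightarrow> bool" where
  "succ_cell a cs Zero \<longleftrightarrow> bigs cs = [] \<and> smalls cs = 0"
| "succ_cell a cs Small \<longleftrightarrow> bigs cs = [] \<and> smalls cs = 1"
| "succ_cell a cs (Big h r) \<longleftrightarrow> bigs cs \<noteq> [] \<and>
     h + smalls cs \<le> (\<Sum>c\<leftarrow>bigs cs. offset c) \<and>
     (length (bigs cs) = 1 \<longrightarrow> r \<le> rank (hd (bigs cs)) \<and>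
        (r = rank (hd (bigs cs)) \<longrightarrow> a = loop_letter r))"

lemma sum_list_fits:
  assumes "\<And>k. k \<in> set ks \<Longrightarrow> fits (c k) (\<alpha> k) (\<beta> k)"
  shows "(\<Sum>k\<leftarrow>ks. \<alpha> k) + (\<Sum>b\<leftarrow>bigs (map c ks). offset b)
            \<le> 3 * (\<Sum>k\<leftarrow>ks. \<beta> k) + smalls (map c ks)" (is ?bound)
    and "bigs (map c ks) = [] \<Longrightarrow> (\<Sum>k\<leftarrow>ks. \<alpha> k) = smalls (map c ks)" (is "?e \<Longrightarrow> ?smalls")
    and "(\<Sum>k\<leftarrow>ks. \<beta> k) = (\<Sum>k\<leftarrow>filter (\<lambda>k. is_Big (c k)) ks. \<beta> k)" (is ?bigs)
    and "0 \<le> (\<Sum>k\<leftarrow>ks. \<alpha> k)" (is ?nonneg)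
proof -
  have "?bound \<and> (?e \<longrightarrow> ?smalls) \<and> ?bigs \<and> ?nonneg"
    using assms
  proof (induction ks)
    case (Cons k ks)
    then have "fits (c k) (\<alpha> k) (\<beta> k)"
      by simp
    with Cons show ?case
      by (cases "c k") (auto simp: fits_def bigs_def smalls_def)
  qed (simp add: bigs_def smalls_def)
  then show ?bound "?e \<Longrightarrow> ?smalls" ?bigs ?nonneg
    by blast+
qed

lemma sum_list_ge:
  fixes f :: "'a \<Rightarrow> real"
  assumes "\<And>k. k \<in> set ks \<Longrightarrow> R \<le> f k"
  shows "real (length ks) * R \<le> (\<Sum>k\<leftarrow>ks. f k)"
  using assms by (induction ks) (auto simp: algebra_simps intro: add_mono)

lemma bigs_map: "bigs (map c ks) = map c (filter (\<lambda>k. is_Big (c k)) ks)"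
  by (simp add: bigs_def filter_map comp_def)

lemma fits_succ_cell:
  assumes fits: "\<And>k. k \<in> set ks \<Longrightarrow> fits (c k) (\<alpha> k) (\<beta> k)"
    and succ: "succ_cell a (map c ks) d"
  shows "fits d (\<Sum>k\<leftarrow>ks. \<alpha> k) (\<Sum>k\<leftarrow>ks. \<beta> k)"
proof (cases d)
  case (Big h r)
  let ?bs = "filter (\<lambda>k. is_Big (c k)) ks"
  have "1 \<le> \<beta> k" if "k \<in> set ?bs" for k
    using fits [of k] that by (cases "c k") (auto simp: fits_def)
  then have "real (length ?bs) * 1 \<le> (\<Sum>k\<leftarrow>?bs. \<beta> k)"
    by (rule sum_list_ge)
  moreover have "1 \<le> length ?bs"
    using succ Big by (cases ?bs) (auto simp: bigs_map)
  ultimately have "1 \<le> (\<Sum>k\<leftarrow>ks. \<beta> k)"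
    using sum_list_fits(3) [of ks c \<alpha> \<beta>, OF fits] by simp
  moreover have "real (h + smalls (map c ks)) \<le> real (\<Sum>b\<leftarrow>bigs (map c ks). offset b)"
    using succ Big by (simp only: succ_cell.simps of_nat_le_iff)
  ultimately show ?thesis
    using Big sum_list_fits(1,4) [of ks c \<alpha> \<beta>, OF fits] by (simp add: fits_def)
qed (use succ sum_list_fits(2,3) [of ks c \<alpha> \<beta>, OF fits] in
    \<open>auto simp: fits_def bigs_map filter_empty_conv\<close>)

text \<open>
  With two or more \<open>Big\<close> addends, all at least \<open>R \<ge> 1\<close>, the sum is at least \<open>2 * R \<ge> R + 1\<close>; otherwise
  it is a copy of a single entry.
\<close>

lemma succ_cell_growth:
  assumes fits: "\<And>k. k \<in> set ks \<Longrightarrow> fits (c k) (\<alpha> k) (\<beta> k)"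
    and succ: "succ_cell a (map c ks) d" and d: "is_Big d"
    and R: "1 \<le> R" "\<And>k. k \<in> set ks \<Longrightarrow> is_Big (c k) \<Longrightarrow> R \<le> \<beta> k"
  shows "R + 1 \<le> (\<Sum>k\<leftarrow>ks. \<beta> k) \<or>
    (\<exists>k\<in>set ks. is_Big (c k) \<and> (\<Sum>k\<leftarrow>ks. \<beta> k) = \<beta> k \<and> rank d \<le> rank (c k) \<and>
       (rank d = rank (c k) \<longrightarrow> a = loop_letter (rank d)))"
proof -
  let ?bs = "filter (\<lambda>k. is_Big (c k)) ks"
  note sum = sum_list_fits(3) [of ks c \<alpha> \<beta>, OF fits]
  obtain h r where hr: "d = Big h r"
    using d by (cases d) auto
  show ?thesis
  proof (cases "length ?bs = 1")
    case True
    then obtain k where k: "?bs = [k]"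
      by (auto simp: length_Suc_conv)
    then have "k \<in> set ks" "is_Big (c k)"
      by (auto dest!: arg_cong [of _ _ set])
    moreover have "(\<Sum>k\<leftarrow>ks. \<beta> k) = \<beta> k"
      using sum k by simp
    ultimately show ?thesis
      using succ by (auto simp: hr bigs_map k)
  next
    case False
    moreover have "?bs \<noteq> []"
      using succ by (auto simp: hr bigs_map)
    ultimately have "2 \<le> length ?bs"
      by (cases ?bs; cases "tl ?bs") auto
    then have "2 * R \<le> real (length ?bs) * R"
      using R(1) by (intro mult_right_mono) auto
    also have "\<dots> \<le> (\<Sum>k\<leftarrow>ks. \<beta> k)"
      by (subst sum) (use R(2) in \<open>auto intro!: sum_list_ge\<close>)
    finally show ?thesis
      using R(1) by simp
  qed
qed

text \<open>
  The pattern of \<open>Zero\<close>, \<open>Small\<close> and \<open>Big\<close> cells determines the successor, so the first 18 rows are the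
  patterns with both levels that arise from the start words below. The last two are patterns with
  a single level, the starting points for start words with only one nonzero row support. The offsets
  in the first 18 rows are the greatest ones, bounded by 3, that are consistent with all transitions. The ranks come from the
  graph of copies, whose only cycles are two cycles of length 4 reading 0 and two loops reading 2: they
  decrease along all its other edges.
\<close>

definition states :: "cell list list" where
  "states =
   [[Zero, Zero, Big 2 0, Big 2 0, Zero, Small, Zero],
    [Zero, Zero, Big 2 5, Big 1 2, Small, Big 3 0, Zero],
    [Zero, Zero, Big 2 0, Big 3 0, Big 2 0, Small, Zero],
    [Small, Zero, Zero, Big 2 4, Big 2 2, Zero, Zero],
    [Small, Zero, Zero, Big 2 3, Big 3 8, Zero, Small],
    [Small, Zero, Big 2 5, Big 3 2, Zero, Zero, Zero],
    [Small, Zero, Big 1 0, Big 3 0, Big 1 0, Zero, Zero],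
    [Big 3 6, Zero, Zero, Small, Small, Zero, Big 2 4],
    [Big 3 3, Zero, Zero, Small, Big 0 0, Zero, Big 3 0],
    [Big 0 0, Zero, Zero, Big 3 0, Big 3 2, Zero, Small],
    [Big 1 1, Zero, Small, Big 1 2, Big 2 4, Zero, Zero],
    [Big 2 1, Zero, Big 1 1, Small, Zero, Zero, Zero],
    [Big 2 1, Zero, Big 3 2, Small, Small, Zero, Zero],
    [Big 1 1, Zero, Big 3 3, Big 0 0, Small, Zero, Zero],
    [Big 2 7, Small, Zero, Zero, Zero, Zero, Big 3 2],
    [Big 2 2, Small, Big 2 4, Zero, Zero, Zero, Zero],
    [Big 2 3, Big 2 4, Zero, Zero, Zero, Zero, Small],
    [Big 2 6, Big 3 2, Small, Zero, Zero, Zero, Zero],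
    [Big 0 0, Zero, Zero, Zero, Big 0 0, Zero, Big 0 0],
    [Big 0 0, Zero, Big 0 0, Big 0 0, Big 0 0, Zero, Zero]]"

definition addends :: "nat \<Rightarrow> cell list \<Rightarrow> nat \<Rightarrow> cell list" where
  "addends a \<sigma> k = map (\<lambda>i. \<sigma> ! (i - 1)) (preds a k)"

definition succ_state :: "nat \<Rightarrow> cell list \<Rightarrow> cell list \<Rightarrow> bool" where
  "succ_state a \<sigma> \<tau> \<longleftrightarrow> (\<forall>k\<in>set [1..<8]. succ_cell a (addends a \<sigma> k) (\<tau> ! (k - 1)))"

text \<open>
  After the letter \<open>a\<close> either no column has a positive entry of \<open>\<beta>\<close>, or each column that does not vanish
  has one. In the second case the offsets still cover all added units, so that \<open>\<alpha> \<le> 3 * \<beta>\<close>.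
\<close>

definition one_level :: "nat \<Rightarrow> cell list \<Rightarrow> bool" where
  "one_level a \<sigma> \<longleftrightarrow>
     (\<forall>k\<in>set [1..<8]. bigs (addends a \<sigma> k) = []) \<or>
     (\<forall>k\<in>set [1..<8]. succ_cell a (addends a \<sigma> k) Zero \<or>
        bigs (addends a \<sigma> k) \<noteq> [] \<and>
        smalls (addends a \<sigma> k) \<le> (\<Sum>c\<leftarrow>bigs (addends a \<sigma> k). offset c))"

lemma states_step:
  "\<forall>a\<in>set [0, 1, 2]. \<forall>\<sigma>\<in>set states. one_level a \<sigma> \<or> (\<exists>\<tau>\<in>set states. succ_state a \<sigma> \<tau>)"
  by code_simp

definition fits_state :: "cell list \<Rightarrow> real ^ 7 \<Rightarrow> real ^ 7 \<Rightarrow> bool" where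
  "fits_state \<sigma> \<alpha> \<beta> \<longleftrightarrow>
     (\<forall>k\<in>{1..7}. fits (\<sigma> ! (k - 1)) (\<alpha> $ of_nat k) (\<beta> $ of_nat k))"

text \<open>
  The pair has lost one of its two levels: there is no column with \<open>\<beta>\<close> positive, or none with only \<open>\<alpha>\<close>
  positive, the ratio bound holding in all columns. Both alternatives are linear, hence preserved by every nonnegative matrix.
\<close>

definition flat :: "real ^ 7 \<Rightarrow> real ^ 7 \<Rightarrow> bool" where
  "flat \<alpha> \<beta> \<longleftrightarrow> \<beta> = 0 \<or> (\<forall>j. \<alpha> $ j \<le> 3 * \<beta> $ j)"

lemma set_upt_1_8: "set [1..<8] = {1..7 :: nat}"
  by auto

lemma preds_range:
  assumes "a \<in> {0, 1, 2}" "k \<in> {1..7}" "i \<in> set (preds a k)"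
  shows "i \<in> {1..7}"
proof -
  have "\<forall>a\<in>set [0, 1, 2]. \<forall>k\<in>set [1..<8]. list_all (\<lambda>i. 1 \<le> i \<and> i \<le> 7) (preds a k)"
    by code_simp
  moreover have "a \<in> set [0, 1, 2]"
    using assms(1) by simp
  ultimately have "list_all (\<lambda>i. 1 \<le> i \<and> i \<le> 7) (preds a k)"
    using assms(2) unfolding set_upt_1_8 by blast
  then show ?thesis
    using assms(3) unfolding list_all_iff by simp
qed

lemma fits_state_addends:
  assumes "a \<in> {0, 1, 2}" "k \<in> {1..7}" "fits_state \<sigma> \<alpha> \<beta>" "i \<in> set (preds a k)"
  shows "fits (\<sigma> ! (i - 1)) (\<alpha> $ of_nat i) (\<beta> $ of_nat i)"
  using assms preds_range [of a k i] by (auto simp: fits_state_def)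

lemma fits_state_succ:
  assumes "a \<in> {0, 1, 2}" "fits_state \<sigma> \<alpha> \<beta>" "succ_state a \<sigma> \<tau>"
  shows "fits_state \<tau> (\<alpha> v* A a) (\<beta> v* A a)"
  unfolding fits_state_def
proof
  fix k :: nat assume k: "k \<in> {1..7}"
  have "succ_cell a (map (\<lambda>i. \<sigma> ! (i - 1)) (preds a k)) (\<tau> ! (k - 1))"
    using assms(3) k unfolding succ_state_def addends_def set_upt_1_8 by blast
  then show "fits (\<tau> ! (k - 1)) ((\<alpha> v* A a) $ of_nat k) ((\<beta> v* A a) $ of_nat k)"
    unfolding vec_mult_A [OF assms(1) k]
    by (rule fits_succ_cell [rotated]) (use assms k in \<open>blast intro: fits_state_addends\<close>)
qed

lemma flat_if_one_level:
  assumes a: "a \<in> {0, 1, 2}" and fits: "fits_state \<sigma> \<alpha> \<beta>" and one: "one_level a \<sigma>"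
  shows "flat (\<alpha> v* A a) (\<beta> v* A a)"
proof -
  let ?bs = "\<lambda>k. bigs (addends a \<sigma> k)"
  have sums: "(\<alpha> v* A a) $ of_nat k + (\<Sum>b\<leftarrow>?bs k. offset b)
        \<le> 3 * (\<beta> v* A a) $ of_nat k + smalls (addends a \<sigma> k)"
      "?bs k = [] \<Longrightarrow> (\<beta> v* A a) $ of_nat k = 0" if k: "k \<in> {1..7}" for k
  proof -
    note * = sum_list_fits [of "preds a k" "\<lambda>i. \<sigma> ! (i - 1)" "\<lambda>i. \<alpha> $ of_nat i" "\<lambda>i. \<beta> $ of_nat i",
        OF fits_state_addends [OF a k fits], folded addends_def]
    show "(\<alpha> v* A a) $ of_nat k + (\<Sum>b\<leftarrow>?bs k. offset b)
        \<le> 3 * (\<beta> v* A a) $ of_nat k + smalls (addends a \<sigma> k)"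
      unfolding vec_mult_A [OF a k] by (rule *(1))
    show "(\<beta> v* A a) $ of_nat k = 0" if "?bs k = []"
      unfolding vec_mult_A [OF a k] using that *(3) by (simp add: addends_def bigs_map)
  qed
  from one consider "\<forall>k\<in>{1..7}. ?bs k = []" | "\<forall>k\<in>{1..7}. succ_cell a (addends a \<sigma> k) Zero \<or>
        ?bs k \<noteq> [] \<and> smalls (addends a \<sigma> k) \<le> (\<Sum>c\<leftarrow>?bs k. offset c)"
    unfolding one_level_def set_upt_1_8 by blast
  then show ?thesis
  proof cases
    case 1
    have "(\<beta> v* A a) $ j = 0" for j
      by (rule index_7_cases [of j]) (use 1 sums(2) in auto)
    then show ?thesis
      by (simp add: flat_def vec_eq_iff)
  next
    case 2
    have "(\<alpha> v* A a) $ j \<le> 3 * (\<beta> v* A a) $ j" for j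
    proof (rule index_7_cases [of j])
      fix k assume k: "k \<in> {1..7}" and j: "j = of_nat k"
      have "real (smalls (addends a \<sigma> k)) \<le> real (\<Sum>c\<leftarrow>?bs k. offset c)"
        using 2 k by (fastforce simp only: of_nat_le_iff succ_cell.simps)
      with sums(1) [OF k] j show ?thesis by simp
    qed
    then show ?thesis
      by (simp add: flat_def)
  qed
qed

lemma state_step:
  assumes "a \<in> {0, 1, 2}" "\<sigma> \<in> set states" "fits_state \<sigma> \<alpha> \<beta>"
  shows "flat (\<alpha> v* A a) (\<beta> v* A a) \<or>
    (\<exists>\<tau>\<in>set states. succ_state a \<sigma> \<tau> \<and> fits_state \<tau> (\<alpha> v* A a) (\<beta> v* A a))"
proof -
  have "a \<in> set [0, 1, 2]"
    using assms(1) by simp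
  then have "one_level a \<sigma> \<or> (\<exists>\<tau>\<in>set states. succ_state a \<sigma> \<tau>)"
    using states_step assms(2) by blast
  then show ?thesis
    using flat_if_one_level [OF assms(1,3)] fits_state_succ [OF assms(1,3)] by blast
qed

lemma vec_mult_mono:
  fixes x y :: "real ^ 'n"
  assumes "nonneg_mat M" "\<And>j. x $ j \<le> y $ j"
  shows "(x v* M) $ j \<le> (y v* M) $ j"
  using assms by (auto simp: vector_matrix_mult_def nonneg_mat_def intro!: sum_mono mult_left_mono mult_right_mono)

lemma vec_mult_nth_scale: "((c *\<^sub>R x) v* (M :: real ^ 'n ^ 'n)) $ j = c * (x v* M) $ j"
  by (simp add: vector_matrix_mult_def sum_distrib_left mult_ac)

lemma flat_mult:
  assumes "flat \<alpha> \<beta>" "nonneg_mat M"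
  shows "flat (\<alpha> v* M) (\<beta> v* M)"
proof (cases "\<beta> = 0")
  case True
  then show ?thesis by (simp add: flat_def)
next
  case False
  then have "\<alpha> $ j \<le> (3 *\<^sub>R \<beta>) $ j" for j
    using assms(1) by (simp add: flat_def)
  from vec_mult_mono [OF assms(2) this] show ?thesis
    unfolding vec_mult_nth_scale flat_def by blast
qed

lemma nonincreasing_nat_eventually_const:
  fixes f :: "nat \<Rightarrow> nat"
  assumes "\<And>m. m \<ge> m0 \<Longrightarrow> f (Suc m) \<le> f m"
  obtains m1 where "m1 \<ge> m0" "\<And>m. m \<ge> m1 \<Longrightarrow> f m = f m1"
proof -
  obtain m1 where m1: "m1 \<ge> m0" and least: "\<And>m. m \<ge> m0 \<Longrightarrow> f m1 \<le> f m"
    using ex_has_least_nat [of "\<lambda>m. m \<ge> m0" m0 f] by auto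
  have "f m \<le> f m1" if "m \<ge> m1" for m
    using that
  proof (induction rule: dec_induct)
    case (step n)
    then show ?case using assms [of n] m1 by simp
  qed simp
  then show ?thesis
    using that [OF m1] least m1 by (meson le_antisym le_trans)
qed

text \<open>
  Induction on \<open>R\<close>. If the minimum of \<open>\<beta>\<close> over the \<open>Big\<close> cells never rose by one, then at every late
  time there would be cells near the minimum, each of them a copy of one such cell at the time
  before. The largest rank among them would be nonincreasing, hence eventually constant, and then every
  letter would have to be the loop letter of that rank.
\<close>

lemma big_cells_grow:
  assumes a: "\<And>m. a m \<in> {0, 1, 2}"
    and not_const: "\<And>m r. \<exists>m'\<ge>m. a m' \<noteq> loop_letter r"
    and fits: "\<And>m. fits_state (\<sigma> m) (\<alpha> m) (\<beta> m)"
    and succ: "\<And>m. succ_state (a m) (\<sigma> m) (\<sigma> (Suc m))"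
    and \<beta>_Suc: "\<And>m. \<beta> (Suc m) = \<beta> m v* A (a m)"
  shows "\<exists>m0. \<forall>m\<ge>m0. \<forall>k\<in>{1..7}. is_Big (\<sigma> m ! (k - 1)) \<longrightarrow> real R + 1 \<le> \<beta> m $ of_nat k"
proof -
  define big where "big m = {k \<in> {1..7}. is_Big (\<sigma> m ! (k - 1))}" for m
  define rk where "rk m k = rank (\<sigma> m ! (k - 1))" for m k
  have grow: "x + 1 \<le> \<beta> (Suc m) $ of_nat k \<or>
      (\<exists>i\<in>big m. \<beta> (Suc m) $ of_nat k = \<beta> m $ of_nat i \<and> rk (Suc m) k \<le> rk m i \<and>
         (rk (Suc m) k = rk m i \<longrightarrow> a m = loop_letter (rk (Suc m) k)))"
    if x: "1 \<le> x" "\<And>i. i \<in> big m \<Longrightarrow> x \<le> \<beta> m $ of_nat i" and k: "k \<in> big (Suc m)" for m k x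
  proof -
    have k7: "k \<in> {1..7}" and big: "is_Big (\<sigma> (Suc m) ! (k - 1))"
      using k by (auto simp: big_def)
    have "succ_cell (a m) (map (\<lambda>i. \<sigma> m ! (i - 1)) (preds (a m) k)) (\<sigma> (Suc m) ! (k - 1))"
      using succ [of m] k7 unfolding succ_state_def addends_def set_upt_1_8 by blast
    from succ_cell_growth [OF fits_state_addends [OF a k7 fits] this big x(1)]
    have "x + 1 \<le> \<beta> (Suc m) $ of_nat k \<or>
      (\<exists>i\<in>set (preds (a m) k). is_Big (\<sigma> m ! (i - 1)) \<and> \<beta> (Suc m) $ of_nat k = \<beta> m $ of_nat i \<and>
         rk (Suc m) k \<le> rk m i \<and> (rk (Suc m) k = rk m i \<longrightarrow> a m = loop_letter (rk (Suc m) k)))"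
      unfolding \<beta>_Suc vec_mult_A [OF a k7] rk_def
      using x(2) preds_range [OF a k7] by (simp add: big_def)
    then show ?thesis
      using preds_range [OF a k7] unfolding big_def by blast
  qed
  have keep: "\<forall>k\<in>big m. x \<le> \<beta> m $ of_nat k"
    if x: "1 \<le> x" "\<forall>k\<in>big m0. x \<le> \<beta> m0 $ of_nat k" and m: "m0 \<le> m" for x m m0
    using m
  proof (induction rule: dec_induct)
    case (step m)
    show ?case
    proof
      fix k assume "k \<in> big (Suc m)"
      from grow [OF x(1) _ this] step.IH show "x \<le> \<beta> (Suc m) $ of_nat k"
        by force
    qed
  qed (use x in simp)
  have "\<exists>m0. \<forall>m\<ge>m0. \<forall>k\<in>big m. real R + 1 \<le> \<beta> m $ of_nat k"
  proof (induction R)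
    case 0
    have "1 \<le> \<beta> m $ of_nat k" if "k \<in> big m" for m k
      using fits [of m] that
      by (cases "\<sigma> m ! (k - 1)") (auto simp: fits_state_def fits_def big_def dest!: bspec)
    then show ?case by simp
  next
    case (Suc R)
    define x where "x = real R + 1"
    have x1: "1 \<le> x" by (simp add: x_def)
    obtain m0 where m0: "\<And>m k. m \<ge> m0 \<Longrightarrow> k \<in> big m \<Longrightarrow> x \<le> \<beta> m $ of_nat k"
      using Suc unfolding x_def by blast
    have "\<exists>m1\<ge>m0. \<forall>k\<in>big m1. x + 1 \<le> \<beta> m1 $ of_nat k"
    proof (rule ccontr)
      assume contra: "\<not> ?thesis"
      define low where "low m = {k \<in> big m. \<beta> m $ of_nat k < x + 1}" for m
      define \<rho> where "\<rho> m = Max (rk m ` low m)" for m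
      have fin: "finite (low m)" for m
        by (simp add: low_def big_def)
      have ne: "low m \<noteq> {}" if "m \<ge> m0" for m
      proof -
        have "\<not> (\<forall>k\<in>big m. x + 1 \<le> \<beta> m $ of_nat k)"
          using contra that by blast
        then show ?thesis
          by (auto simp: low_def not_le)
      qed
      have pred: "\<exists>i\<in>low m. rk (Suc m) k \<le> rk m i \<and>
          (rk (Suc m) k = rk m i \<longrightarrow> a m = loop_letter (rk (Suc m) k))"
        if m: "m \<ge> m0" and k: "k \<in> low (Suc m)" for m k
        using grow [OF x1 m0 [OF m], of k] k unfolding low_def by auto
      have \<rho>: "\<rho> (Suc m) \<le> \<rho> m \<and> (\<rho> (Suc m) = \<rho> m \<longrightarrow> a m = loop_letter (\<rho> m))"
        if m: "m \<ge> m0" for m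
      proof -
        have "\<rho> (Suc m) \<in> rk (Suc m) ` low (Suc m)"
          unfolding \<rho>_def using fin ne m by (intro Max_in) auto
        then obtain k where k: "k \<in> low (Suc m)" "\<rho> (Suc m) = rk (Suc m) k"
          by blast
        obtain i where i: "i \<in> low m" "rk (Suc m) k \<le> rk m i"
          "rk (Suc m) k = rk m i \<longrightarrow> a m = loop_letter (rk (Suc m) k)"
          using pred [OF m k(1)] by blast
        have "rk m i \<le> \<rho> m"
          unfolding \<rho>_def using i(1) fin by (intro Max_ge) auto
        with i k show ?thesis by auto
      qed
      obtain m1 where "m1 \<ge> m0" and m1: "\<And>m. m \<ge> m1 \<Longrightarrow> \<rho> m = \<rho> m1"
        using nonincreasing_nat_eventually_const [of m0 \<rho>] \<rho> by blast
      have "a m = loop_letter (\<rho> m1)" if "m \<ge> m1" for m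
        using \<rho> [of m] m1 [of m] m1 [of "Suc m"] that \<open>m1 \<ge> m0\<close> by simp
      with not_const show False by blast
    qed
    then obtain m1 where "\<forall>k\<in>big m1. x + 1 \<le> \<beta> m1 $ of_nat k" by blast
    from keep [OF _ this] x1 show ?case
      by (intro exI [of _ m1]) (simp add: x_def add.commute)
  qed
  then show ?thesis
    unfolding big_def by blast
qed

text \<open>
  The two facts on \<open>(\<alpha>, \<beta>)\<close> that \<open>H2\<close> and \<open>H3\<close> rest on. The first must hold from the start on with a
  universal constant; the second only eventually, but for every factor \<open>R\<close>.
\<close>

lemma two_rows_along_word:
  assumes a: "\<And>m. a m \<in> {0, 1, 2}"
    and not_const: "\<And>m r. \<exists>m'\<ge>m. a m' \<noteq> loop_letter r"
    and \<sigma>0: "\<sigma>0 \<in> set states" "fits_state \<sigma>0 \<alpha>0 \<beta>0"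
    and \<alpha>: "\<And>m. \<alpha> m = \<alpha>0 v* word_prod (map a [0..<m])"
    and \<beta>: "\<And>m. \<beta> m = \<beta>0 v* word_prod (map a [0..<m])"
  shows "\<beta> m $ j > 0 \<Longrightarrow> \<alpha> m $ j \<le> 3 * \<beta> m $ j"
    and "\<exists>m0. \<forall>m\<ge>m0. \<forall>j j'. \<beta> m $ j > 0 \<longrightarrow> \<beta> m $ j' = 0 \<longrightarrow> real R * \<alpha> m $ j' \<le> \<beta> m $ j"
proof -
  have step: "\<alpha> (Suc m) = \<alpha> m v* A (a m)" "\<beta> (Suc m) = \<beta> m v* A (a m)" for m
    by (simp_all add: \<alpha> \<beta> word_prod_snoc vector_matrix_mul_assoc)
  note Suc_eqs = step
  have zero: "\<alpha> 0 = \<alpha>0" "\<beta> 0 = \<beta>0"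
    by (simp_all add: \<alpha> \<beta>)
  have inv: "flat (\<alpha> m) (\<beta> m) \<or> (\<exists>\<sigma>\<in>set states. fits_state \<sigma> (\<alpha> m) (\<beta> m))" for m
  proof (induction m)
    case 0
    then show ?case using \<sigma>0 by (auto simp: zero)
  next
    case (Suc m)
    then show ?case
      using state_step [OF a, of _ "\<alpha> m" "\<beta> m" m] flat_mult [OF _ nonneg_A, of "\<alpha> m" "\<beta> m" "a m"]
      unfolding step by blast
  qed
  show "\<alpha> m $ j \<le> 3 * \<beta> m $ j" if pos: "\<beta> m $ j > 0"
  proof (cases "flat (\<alpha> m) (\<beta> m)")
    case True
    then show ?thesis
      using pos by (auto simp: flat_def)
  next
    case False
    obtain k where k: "k \<in> {1..7}" "j = of_nat k" by (rule index_7_cases)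
    obtain \<sigma> where "fits_state \<sigma> (\<alpha> m) (\<beta> m)"
      using inv [of m] False by blast
    then have "fits (\<sigma> ! (k - 1)) (\<alpha> m $ j) (\<beta> m $ j)"
      using k by (simp add: fits_state_def)
    with pos show ?thesis
      by (cases "\<sigma> ! (k - 1)") (auto simp: fits_def)
  qed
  show "\<exists>m0. \<forall>m\<ge>m0. \<forall>j j'. \<beta> m $ j > 0 \<longrightarrow> \<beta> m $ j' = 0 \<longrightarrow> real R * \<alpha> m $ j' \<le> \<beta> m $ j"
  proof (cases "\<exists>m0. flat (\<alpha> m0) (\<beta> m0)")
    case True
    then obtain m0 where m0: "flat (\<alpha> m0) (\<beta> m0)" by blast
    have flat: "flat (\<alpha> m) (\<beta> m)" if "m0 \<le> m" for m
      using that
    proof (induction rule: dec_induct)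
      case (step n)
      then show ?case
        by (simp add: Suc_eqs flat_mult nonneg_A)
    qed (rule m0)
    have "real R * \<alpha> m $ j' \<le> \<beta> m $ j"
      if "m0 \<le> m" "\<beta> m $ j > 0" "\<beta> m $ j' = 0" for m j j'
    proof -
      have "\<alpha> m $ j' \<le> 3 * \<beta> m $ j'"
        using flat [OF that(1)] that(2) by (auto simp: flat_def)
      then have "real R * \<alpha> m $ j' \<le> 0"
        using that(3) by (simp add: mult_nonneg_nonpos)
      with that(2) show ?thesis by linarith
    qed
    then show ?thesis by blast
  next
    case False
    have "\<exists>\<sigma>. \<forall>m. (\<sigma> m \<in> set states \<and> fits_state (\<sigma> m) (\<alpha> m) (\<beta> m)) \<and>
        succ_state (a m) (\<sigma> m) (\<sigma> (Suc m))"
    proof (rule dependent_nat_choice)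
      show "\<exists>\<sigma>. \<sigma> \<in> set states \<and> fits_state \<sigma> (\<alpha> 0) (\<beta> 0)"
        using \<sigma>0 by (auto simp: zero)
    next
      fix \<sigma> m assume "\<sigma> \<in> set states \<and> fits_state \<sigma> (\<alpha> m) (\<beta> m)"
      then show "\<exists>\<tau>. (\<tau> \<in> set states \<and> fits_state \<tau> (\<alpha> (Suc m)) (\<beta> (Suc m))) \<and>
          succ_state (a m) \<sigma> \<tau>"
        using state_step [OF a, of \<sigma> "\<alpha> m" "\<beta> m" m] False unfolding step [symmetric] by blast
    qed
    then obtain \<sigma> where fits: "\<And>m. fits_state (\<sigma> m) (\<alpha> m) (\<beta> m)"
      and succ: "\<And>m. succ_state (a m) (\<sigma> m) (\<sigma> (Suc m))"
      by blast
    obtain m0 where m0: "\<And>m k. m \<ge> m0 \<Longrightarrow> k \<in> {1..7} \<Longrightarrow> is_Big (\<sigma> m ! (k - 1)) \<Longrightarrow>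
        real R + 1 \<le> \<beta> m $ of_nat k"
      using big_cells_grow [OF a not_const fits succ step(2), of R] by blast
    have "real R * \<alpha> m $ j' \<le> \<beta> m $ j"
      if m: "m0 \<le> m" and pos: "\<beta> m $ j > 0" and zero: "\<beta> m $ j' = 0" for m j j'
    proof -
      obtain k where k: "k \<in> {1..7}" "j = of_nat k" by (rule index_7_cases)
      obtain k' where k': "k' \<in> {1..7}" "j' = of_nat k'" by (rule index_7_cases)
      have "fits (\<sigma> m ! (k - 1)) (\<alpha> m $ j) (\<beta> m $ j)" "fits (\<sigma> m ! (k' - 1)) (\<alpha> m $ j') (\<beta> m $ j')"
        using fits [of m] k k' by (simp_all add: fits_state_def)
      then have "is_Big (\<sigma> m ! (k - 1))" "\<alpha> m $ j' \<le> 1"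
        using pos zero
        by (cases "\<sigma> m ! (k - 1)"; cases "\<sigma> m ! (k' - 1)"; auto simp: fits_def)+
      then have "real R * \<alpha> m $ j' \<le> real R * 1" "real R + 1 \<le> \<beta> m $ j"
        using m0 [OF m k(1)] k(2) by (auto intro: mult_left_mono simp del: mult_1_right)
      then show ?thesis by simp
    qed
    then show ?thesis by blast
  qed
qed

section \<open>Words whose product has two levels\<close>

text \<open>
  Element \<open>k - 1\<close> of this list enumerates the rows in which column \<open>k\<close> of the product of \<open>z\<close> is nonzero.
\<close>

definition sources :: "nat list \<Rightarrow> nat list list" where
  "sources z = foldl
     (\<lambda>S a. map (\<lambda>k. remdups (concat (map (\<lambda>i. S ! (i - 1)) (preds a k)))) [1..<8])
     (map (\<lambda>k. [k]) [1..<8]) z"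

lemma nonneg_mat_mult: "nonneg_mat M \<Longrightarrow> nonneg_mat N \<Longrightarrow> nonneg_mat (M ** N)"
  by (simp add: nonneg_mat_def matrix_matrix_mult_def sum_nonneg)

lemma nonneg_word_prod: "nonneg_mat (word_prod u)"
proof (induction u)
  case (Cons a u)
  then show ?case
    using nonneg_mat_mult [OF nonneg_A] by (simp add: word_prod_def)
qed (simp add: nonneg_mat_def mat_def)

lemma word_prod_neq_0_iff:
  assumes "set z \<subseteq> {0, 1, 2}" "i \<in> {1..7}" "k \<in> {1..7}"
  shows "word_prod z $ of_nat i $ of_nat k \<noteq> 0 \<longleftrightarrow> i \<in> set (sources z ! (k - 1))"
  using assms(1,3)
proof (induction z arbitrary: k rule: rev_induct)
  case Nil
  then have "k - 1 < length [1..<8]" "[1..<8] ! (k - 1) = k"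
    by auto
  then have "sources [] ! (k - 1) = [k]"
    unfolding sources_def foldl_Nil by (subst nth_map) simp_all
  then show ?case
    using Nil assms(2) of_nat_7_eq_iff [of i k] by (simp add: mat_1_nth)
next
  case (snoc a z)
  have a: "a \<in> {0, 1, 2}" and z: "set z \<subseteq> {0, 1, 2}"
    using snoc.prems by auto
  have "word_prod (z @ [a]) $ of_nat i $ of_nat k =
      (\<Sum>l\<leftarrow>preds a k. word_prod z $ of_nat i $ of_nat l)"
    unfolding word_prod_snoc by (rule mult_A_nth [OF a snoc.prems(2)])
  also have "\<dots> \<noteq> 0 \<longleftrightarrow> (\<exists>l\<in>set (preds a k). word_prod z $ of_nat i $ of_nat l \<noteq> 0)"
    using nonneg_word_prod [of z] by (subst sum_list_nonneg_eq_0_iff) (auto simp: nonneg_mat_def)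
  also have "\<dots> \<longleftrightarrow> (\<exists>l\<in>set (preds a k). i \<in> set (sources z ! (l - 1)))"
    using snoc.IH [OF z] preds_range [OF a snoc.prems(2)] by blast
  also have "\<dots> \<longleftrightarrow> i \<in> set (sources (z @ [a]) ! (k - 1))"
    using snoc.prems(2) by (auto simp: sources_def simp del: upt_Suc upt_rec_numeral)
  finally show ?case .
qed

text \<open>
  Every row of the product of \<open>z\<close> is zero, or is supported by the \<open>Big\<close> cells of \<open>\<sigma>\<close>, or by all its cells
  other than \<open>Zero\<close>. Offsets up to 3 are admissible because at the beginning \<open>\<beta> = 1\<close> and \<open>\<alpha> = 0\<close> in
  \<open>Big\<close> cells.
\<close>

definition two_level :: "nat list \<Rightarrow> cell list \<Rightarrow> bool" where
  "two_level z \<sigma> \<longleftrightarrow> (\<forall>c\<in>set \<sigma>. offset c \<le> 3) \<and> length \<sigma> = 7 \<and>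
     (let S = sources z in \<forall>i\<in>set [1..<8].
       (\<forall>k\<in>set [1..<8]. i \<notin> set (S ! (k - 1))) \<or>
       (\<forall>k\<in>set [1..<8]. i \<in> set (S ! (k - 1)) \<longleftrightarrow> is_Big (\<sigma> ! (k - 1))) \<or>
       (\<forall>k\<in>set [1..<8]. i \<in> set (S ! (k - 1)) \<longleftrightarrow> \<sigma> ! (k - 1) \<noteq> Zero))"

definition start_words :: "nat list list" where
  "start_words =
   [[2,2,0], [1,1,2,0], [2,1,2,0], [0,0,1,2,0], [1,0,1,2,0], [0,0,0,2,0], [1,0,2,0],
    [2,0,1], [2,0,2], [1,0,0,2], [2,0,0,2],
    [2,1,0], [2,1,1,0], [2,1,1,2], [2,1,1,1,0], [2,1,1,1,1], [1,1,1,2], [2,1,2,1], [2,1,2,2],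
    [1,0,1,1,0], [0,0,0,1,1,0], [1,0,0,1], [0,1,1,1,0], [0,1,1,1,1], [1,1,1,1,1],
    [1,0,1,0], [0,0,0,1,0,0]]"

lemma start_words_two_level:
  "\<forall>z\<in>set start_words. list_all (\<lambda>a. a = 0 \<or> a = 1 \<or> a = 2) z \<and> (\<exists>\<sigma>\<in>set states. two_level z \<sigma>)"
  by code_simp

definition occurs_in :: "nat list \<Rightarrow> nat list \<Rightarrow> bool" where
  "occurs_in z w \<longleftrightarrow> (\<exists>i\<in>set [0..<length w]. take (length z) (drop i w) = z)"

text \<open>
  The windows needed to catch a start word: three letters before 20, three letters after 21, four
  letters on both sides of 10 in the absence of 2, and five consecutive 1s.
\<close>

lemma unavoidable:
  "\<forall>u\<in>set (List.n_lists 3 [0,1,2]). \<exists>z\<in>set start_words. occurs_in z (u @ [2,0])"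
  "\<forall>v\<in>set (List.n_lists 3 [0,1,2]). \<exists>z\<in>set start_words. occurs_in z ([2,1] @ v)"
  "\<forall>u\<in>set (List.n_lists 4 [0,1]). \<forall>v\<in>set (List.n_lists 4 [0,1]).
     \<exists>z\<in>set start_words. occurs_in z (u @ [1,0] @ v)"
  "\<exists>z\<in>set start_words. occurs_in z [1,1,1,1,1]"
  by code_simp+

definition row_supports :: "real ^ 7 ^ 7 \<Rightarrow> real ^ 7 \<Rightarrow> real ^ 7 \<Rightarrow> bool" where
  "row_supports M \<alpha> \<beta> \<longleftrightarrow>
     (\<forall>i. \<exists>t\<in>{0, \<beta>, \<beta> + \<alpha>}. \<forall>j. M $ i $ j \<noteq> 0 \<longleftrightarrow> t $ j \<noteq> 0)"

lemma two_level_row_supports: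
  assumes \<sigma>: "two_level z \<sigma>" and z: "set z \<subseteq> {0, 1, 2}"
  shows "\<exists>\<alpha> \<beta>. fits_state \<sigma> \<alpha> \<beta> \<and> row_supports (word_prod z) \<alpha> \<beta> \<and>
    (\<forall>j. \<alpha> $ j \<in> {0, 1} \<and> \<beta> $ j \<in> {0, 1} \<and> (\<alpha> $ j = 0 \<or> \<beta> $ j = 0))"
proof -
  define ind :: "(nat \<Rightarrow> bool) \<Rightarrow> real ^ 7" where
    "ind P = (\<chi> j. if \<exists>k\<in>{1..7}. j = of_nat k \<and> P k then 1 else 0)" for P
  have ind: "ind P $ of_nat k = (if P k then 1 else 0)" if "k \<in> {1..7}" for P k
    using that by (auto simp: ind_def of_nat_7_eq_iff)
  define \<alpha> where "\<alpha> = ind (\<lambda>k. \<sigma> ! (k - 1) = Small)"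
  define \<beta> where "\<beta> = ind (\<lambda>k. is_Big (\<sigma> ! (k - 1)))"
  have offset: "offset (\<sigma> ! (k - 1)) \<le> 3" if "k \<in> {1..7}" for k
    using \<sigma> that unfolding two_level_def by (auto simp del: One_nat_def)
  have "fits_state \<sigma> \<alpha> \<beta>"
    unfolding fits_state_def
  proof
    fix k :: nat assume k: "k \<in> {1..7}"
    then show "fits (\<sigma> ! (k - 1)) (\<alpha> $ of_nat k) (\<beta> $ of_nat k)"
      using offset [OF k] by (cases "\<sigma> ! (k - 1)") (simp_all add: fits_def \<alpha>_def \<beta>_def ind)
  qed
  moreover have "row_supports (word_prod z) \<alpha> \<beta>"
    unfolding row_supports_def
  proof
    fix i' :: 7
    obtain i where i: "i \<in> {1..7}" and i': "i' = of_nat i" by (rule index_7_cases)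
    let ?S = "\<lambda>k. set (sources z ! (k - 1))"
    consider "\<forall>k\<in>{1..7}. i \<notin> ?S k" | "\<forall>k\<in>{1..7}. i \<in> ?S k \<longleftrightarrow> is_Big (\<sigma> ! (k - 1))"
      | "\<forall>k\<in>{1..7}. i \<in> ?S k \<longleftrightarrow> \<sigma> ! (k - 1) \<noteq> Zero"
      using \<sigma> i unfolding two_level_def Let_def set_upt_1_8 by blast
    then show "\<exists>t\<in>{0, \<beta>, \<beta> + \<alpha>}. \<forall>j. word_prod z $ i' $ j \<noteq> 0 \<longleftrightarrow> t $ j \<noteq> 0"
    proof cases
      case 1
      have "word_prod z $ i' $ j = 0" for j
        by (rule index_7_cases [of j]) (use 1 word_prod_neq_0_iff [OF z i] i' in blast)
      then show ?thesis by auto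
    next
      case 2
      have "word_prod z $ i' $ j \<noteq> 0 \<longleftrightarrow> \<beta> $ j \<noteq> 0" for j
        by (rule index_7_cases [of j]) (use 2 word_prod_neq_0_iff [OF z i] in \<open>simp add: i' \<beta>_def ind\<close>)
      then show ?thesis by blast
    next
      case 3
      have "word_prod z $ i' $ j \<noteq> 0 \<longleftrightarrow> (\<beta> + \<alpha>) $ j \<noteq> 0" for j
      proof (rule index_7_cases [of j])
        fix k assume k: "k \<in> {1..7}" and j: "j = of_nat k"
        show ?thesis
          using 3 word_prod_neq_0_iff [OF z i k] k
          by (cases "\<sigma> ! (k - 1)") (simp_all add: i' j \<alpha>_def \<beta>_def ind)
      qed
      then show ?thesis by blast
    qed
  qed
  moreover have "\<alpha> $ j \<in> {0, 1} \<and> \<beta> $ j \<in> {0, 1} \<and> (\<alpha> $ j = 0 \<or> \<beta> $ j = 0)" for j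
    by (rule index_7_cases [of j]) (simp add: \<alpha>_def \<beta>_def ind)
  ultimately show ?thesis
    by blast
qed

text \<open>
  A row of \<open>P ** M\<close> is supported by the union of the supports of those rows of \<open>M\<close> that enter it, and the
  three possible supports are nested.
\<close>

lemma row_supports_left_mult:
  assumes P: "nonneg_mat P" and M: "nonneg_mat M" and sup: "row_supports M \<alpha> \<beta>"
    and nonneg: "\<And>j. 0 \<le> \<alpha> $ j" "\<And>j. 0 \<le> \<beta> $ j"
  shows "row_supports (P ** M) \<alpha> \<beta>"
  unfolding row_supports_def
proof
  fix i
  obtain t where t: "\<And>k. t k \<in> {0, \<beta>, \<beta> + \<alpha>}" and M_t: "\<And>k j. M $ k $ j \<noteq> 0 \<longleftrightarrow> t k $ j \<noteq> 0"
    using sup unfolding row_supports_def by metis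
  have ne: "(P ** M) $ i $ j \<noteq> 0 \<longleftrightarrow> (\<exists>k. P $ i $ k \<noteq> 0 \<and> t k $ j \<noteq> 0)" for j
    using P M by (simp add: matrix_matrix_mult_def nonneg_mat_def sum_nonneg_eq_0_iff flip: M_t)
  consider k where "P $ i $ k \<noteq> 0" "t k = \<beta> + \<alpha>"
    | k where "P $ i $ k \<noteq> 0" "t k = \<beta>" "\<And>k. P $ i $ k \<noteq> 0 \<Longrightarrow> t k \<noteq> \<beta> + \<alpha>"
    | "\<And>k. P $ i $ k \<noteq> 0 \<Longrightarrow> t k = 0"
    using t by blast
  then show "\<exists>t\<in>{0, \<beta>, \<beta> + \<alpha>}. \<forall>j. (P ** M) $ i $ j \<noteq> 0 \<longleftrightarrow> t $ j \<noteq> 0"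
  proof cases
    case 1
    have "(\<exists>k. P $ i $ k \<noteq> 0 \<and> t k $ j \<noteq> 0) \<longleftrightarrow> (\<beta> + \<alpha>) $ j \<noteq> 0" for j
    proof
      assume "\<exists>k. P $ i $ k \<noteq> 0 \<and> t k $ j \<noteq> 0"
      then show "(\<beta> + \<alpha>) $ j \<noteq> 0"
        using t nonneg(1) [of j] nonneg(2) [of j]
        by (metis add_nonneg_eq_0_iff insertE singletonD vector_add_component zero_index)
    qed (use 1 in metis)
    then show ?thesis unfolding ne by blast
  next
    case 2
    then have "(\<exists>k. P $ i $ k \<noteq> 0 \<and> t k $ j \<noteq> 0) \<longleftrightarrow> \<beta> $ j \<noteq> 0" for j
      using t by (metis insertE singletonD zero_index)
    then show ?thesis unfolding ne by blast
  next
    case 3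
    then show ?thesis unfolding ne by auto
  qed
qed

lemma entries_bounded:
  fixes M :: "real ^ 7 ^ 7"
  assumes "nonneg_mat M"
  obtains c \<kappa> where "0 < c" "0 \<le> \<kappa>" "\<And>i j. M $ i $ j \<noteq> 0 \<Longrightarrow> c \<le> M $ i $ j"
    "\<And>i j. M $ i $ j \<le> \<kappa>"
proof -
  define E where "E = range (\<lambda>(i, j). M $ i $ j)"
  have fin: "finite (insert 1 (E - {0}))" "finite (insert 1 E)"
    by (simp_all add: E_def)
  have E: "M $ i $ j \<in> E" for i j
    by (auto simp: E_def)
  have pos: "x > 0" if "x \<in> insert 1 (E - {0})" for x
    using that assms by (auto simp: E_def nonneg_mat_def less_le)
  show ?thesis
  proof
    show "0 < Min (insert 1 (E - {0}))"
      using pos Min_in [OF fin(1)] by blast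
    have "1 \<le> Max (insert 1 E)"
      using fin(2) by (intro Max_ge) auto
    then show "0 \<le> Max (insert 1 E)"
      by linarith
    show "Min (insert 1 (E - {0})) \<le> M $ i $ j" if "M $ i $ j \<noteq> 0" for i j
      using fin(1) E that by (intro Min_le) auto
    show "M $ i $ j \<le> Max (insert 1 E)" for i j
      using fin(2) E by (intro Max_ge) auto
  qed
qed

text \<open>
  The constant \<open>L\<close> depends on the initial matrix \<open>M\<close> only, not on the word \<open>a\<close> that follows it. This is what
  allows the same constants for all blocks beginning with the same start word.
\<close>

lemma good_block:
  assumes M: "nonneg_mat M" and sup: "row_supports M \<alpha>0 \<beta>0"
    and \<sigma>0: "\<sigma>0 \<in> set states" "fits_state \<sigma>0 \<alpha>0 \<beta>0"
    and ind: "\<And>j. \<alpha>0 $ j \<in> {0, 1}" "\<And>j. \<beta>0 $ j \<in> {0, 1}" and disjoint: "\<And>j. \<alpha>0 $ j = 0 \<or> \<beta>0 $ j = 0"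
  shows "\<exists>L. \<forall>a. (\<forall>m. a m \<in> {0, 1, 2}) \<longrightarrow> (\<forall>m r. \<exists>m'\<ge>m. a m' \<noteq> loop_letter r) \<longrightarrow>
    (\<exists>q. \<forall>m\<ge>q. M ** word_prod (map a [0..<m]) \<in> H1 \<inter> H2 L \<inter> H3 (1 / 2))"
proof -
  obtain c \<kappa> where c: "0 < c" and \<kappa>: "0 \<le> \<kappa>"
    and lower: "\<And>i j. M $ i $ j \<noteq> 0 \<Longrightarrow> c \<le> M $ i $ j" and upper: "\<And>i j. M $ i $ j \<le> \<kappa>"
    using entries_bounded [OF M] by blast
  have rows: "\<exists>t\<in>{0, \<beta>0, \<beta>0 + \<alpha>0}. \<forall>j. (c *\<^sub>R t) $ j \<le> M $ i $ j \<and> M $ i $ j \<le> (\<kappa> *\<^sub>R t) $ j" for i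
  proof -
    obtain t where t: "t \<in> {0, \<beta>0, \<beta>0 + \<alpha>0}" "\<And>j. M $ i $ j \<noteq> 0 \<longleftrightarrow> t $ j \<noteq> 0"
      using sup unfolding row_supports_def by blast
    have "t $ j = 0 \<or> t $ j = 1" for j
      using t(1) ind(1) [of j] ind(2) [of j] disjoint [of j] by auto
    then have "(c *\<^sub>R t) $ j \<le> M $ i $ j \<and> M $ i $ j \<le> (\<kappa> *\<^sub>R t) $ j" for j
      using t(2) [of j] lower [of i j] upper [of i j] by (cases "t $ j = 0") fastforce+
    with t(1) show ?thesis by blast
  qed
  show ?thesis
  proof (rule exI, intro allI impI)
    fix a :: "nat \<Rightarrow> nat"
    assume "\<forall>m. a m \<in> {0, 1, 2}" and "\<forall>m r. \<exists>m'\<ge>m. a m' \<noteq> loop_letter r"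
    then have a: "\<And>m. a m \<in> {0, 1, 2}" and not_const: "\<And>m r. \<exists>m'\<ge>m. a m' \<noteq> loop_letter r"
      by iprover+
    define U where "U m = word_prod (map a [0..<m])" for m
    define \<alpha> where "\<alpha> m = \<alpha>0 v* U m" for m
    define \<beta> where "\<beta> m = \<beta>0 v* U m" for m
    have U: "nonneg_mat (U m)" for m
      by (simp add: U_def nonneg_word_prod)
    have nonneg: "0 \<le> \<alpha> m $ j" "0 \<le> \<beta> m $ j" for m j
      using U [of m] ind by (auto simp: \<alpha>_def \<beta>_def vector_matrix_mult_def nonneg_mat_def
        intro!: sum_nonneg mult_nonneg_nonneg) (metis insertE singletonD order_refl zero_le_one)+
    \<comment> \<open>\<open>14 = 2 * 7\<close>: seven rows, and the factor 1/2 of \<open>H3\<close>.\<close>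
    obtain R :: nat where R: "14 * \<kappa> / c \<le> real R"
      using real_arch_simple by blast
    note two = two_rows_along_word [OF a not_const \<sigma>0, of \<alpha> \<beta>, OF \<alpha>_def [unfolded U_def] \<beta>_def [unfolded U_def]]
    obtain q where q: "\<And>m j j'. m \<ge> q \<Longrightarrow> \<beta> m $ j > 0 \<Longrightarrow> \<beta> m $ j' = 0 \<Longrightarrow> real R * \<alpha> m $ j' \<le> \<beta> m $ j"
      using two(2) [of R] by blast
    have "M ** U m \<in> H1 \<inter> H2 (real CARD(7) * \<kappa> * (1 + 3) / c) \<inter> H3 (1 / 2)" if m: "m \<ge> q" for m
    proof (rule two_level_mem_H [OF c \<kappa>, of 3 "1 / 2" "\<beta> m" "\<alpha> m"])
      fix i
      obtain t where t: "t \<in> {0, \<beta>0, \<beta>0 + \<alpha>0}"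
        "\<And>j. (c *\<^sub>R t) $ j \<le> M $ i $ j" "\<And>j. M $ i $ j \<le> (\<kappa> *\<^sub>R t) $ j"
        using rows [of i] by blast
      have "(M ** U m) $ i = M $ i v* U m"
        by (simp add: matrix_matrix_mult_def vector_matrix_mult_def vec_eq_iff mult.commute)
      then have "c * (t v* U m) $ j \<le> (M ** U m) $ i $ j" "(M ** U m) $ i $ j \<le> \<kappa> * (t v* U m) $ j" for j
        using vec_mult_mono [OF U t(2), of m j] vec_mult_mono [OF U t(3), of m j]
        unfolding vec_mult_nth_scale by simp_all
      moreover have "t v* U m \<in> {0, \<beta> m, \<beta> m + \<alpha> m}"
        using t(1) by (auto simp: \<alpha>_def \<beta>_def vector_matrix_left_distrib)
      ultimately show "\<exists>t\<in>{0, \<beta> m, \<beta> m + \<alpha> m}. \<forall>j. c * t $ j \<le> (M ** U m) $ i $ j \<and> (M ** U m) $ i $ j \<le> \<kappa> * t $ j"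
        by blast
    next
      fix j j' assume j: "\<beta> m $ j > 0" "\<beta> m $ j' = 0"
      have "14 * \<kappa> * \<alpha> m $ j' = (14 * \<kappa> / c) * \<alpha> m $ j' * c"
        using c by simp
      also have "\<dots> \<le> real R * \<alpha> m $ j' * c"
        using R nonneg c by (intro mult_right_mono) auto
      also have "\<dots> \<le> \<beta> m $ j * c"
        using q [OF m j] c by (intro mult_right_mono) auto
      finally show "real CARD(7) * \<kappa> * \<alpha> m $ j' \<le> 1 / 2 * (c * \<beta> m $ j)"
        by (simp add: mult_ac)
    qed (use nonneg two(1) in auto)
    then show "\<exists>q. \<forall>m\<ge>q. M ** word_prod (map a [0..<m]) \<in> H1 \<inter> H2 (real CARD(7) * \<kappa> * (1 + 3) / c) \<inter> H3 (1 / 2)"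
      unfolding U_def by blast
  qed
qed

section \<open>Start words occur infinitely often\<close>

lemma shift_power: "(shift ^^ n) \<omega> = (\<lambda>k. \<omega> (k + n))"
  by (induction n) (simp_all add: shift_def add_ac)

lemma X_iff:
  "\<omega> \<in> X \<longleftrightarrow> \<omega> \<in> words \<and> (\<forall>n. \<exists>k\<ge>n. \<omega> k \<noteq> 0) \<and> (\<forall>n. \<exists>k\<ge>n. \<omega> k \<noteq> 2)"
proof -
  have "(shift ^^ n) \<omega> = const_word a \<longleftrightarrow> (\<forall>k\<ge>n. \<omega> k = a)" for n a
    unfolding shift_power const_word_def fun_eq_iff
    by (metis add.commute le_add1 le_add_diff_inverse)
  then show ?thesis
    by (auto simp: X_def)
qed

text \<open>
  If 2 is followed by another letter infinitely often, an occurrence of 20 or 21 gives a start word.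
  Otherwise 2 is absent from some point on, as the word is not eventually 2. Then either 10 occurs
  late, or the word, not being eventually 0, is eventually 1.
\<close>

lemma start_word_occurs:
  assumes "\<omega> \<in> X"
  shows "\<exists>p\<ge>N. \<exists>z\<in>set start_words. map \<omega> [p..<p + length z] = z"
proof -
  let ?occ = "\<exists>p\<ge>N. \<exists>z\<in>set start_words. map \<omega> [p..<p + length z] = z"
  have \<omega>: "\<omega> k \<in> {0, 1, 2}" and not0: "\<exists>k\<ge>n. \<omega> k \<noteq> 0" and not2: "\<exists>k\<ge>n. \<omega> k \<noteq> 2" for k n
    using assms by (auto simp: X_iff words_def)
  have window: ?occ
    if q: "q \<ge> N" and w: "map \<omega> [q..<q + l] = w" and z: "\<exists>z\<in>set start_words. occurs_in z w" for q l w
  proof -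
    obtain z i where z: "z \<in> set start_words" "take (length z) (drop i w) = z" "i < length w"
      using z by (auto simp: occurs_in_def)
    have "length z + i \<le> l"
      using arg_cong [OF z(2), of length] z(3) arg_cong [OF w, of length] by auto
    then have "map \<omega> [q + i..<q + i + length z] = take (length z) (drop i w)"
      unfolding w [symmetric] by (simp add: drop_map take_map take_upt)
    then show ?thesis
      using z q by (intro exI [of _ "q + i"] conjI bexI [of _ z]) auto
  qed
  have split: "map \<omega> [q..<q + (m + l)] = map \<omega> [q..<q + m] @ map \<omega> [q + m..<q + m + l]" for q m l
    using upt_add_eq_append [of q "q + m" l] by (simp add: add.assoc)
  have two: "map \<omega> [q..<q + 2] = [\<omega> q, \<omega> (q + 1)]" for q
    by (simp add: numeral_2_eq_2)
  have letters: "map \<omega> [q..<q + m] \<in> set (List.n_lists m as)" if "\<And>k. k \<ge> q \<Longrightarrow> \<omega> k \<in> set as" for q m as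
    using that by (auto simp: set_n_lists)
  consider (two_zero) n where "\<omega> (N + n + 3) = 2" "\<omega> (N + n + 3 + 1) = 0"
    | (two_one) n where "n \<ge> N" "\<omega> n = 2" "\<omega> (n + 1) = 1"
    | (two_two) "\<And>n. n \<ge> N + 3 \<Longrightarrow> \<omega> n = 2 \<Longrightarrow> \<omega> (n + 1) = 2"
  proof (cases "\<exists>n\<ge>N + 3. \<omega> n = 2 \<and> \<omega> (n + 1) \<noteq> 2")
    case True
    then obtain n where n: "n \<ge> N + 3" "\<omega> n = 2" "\<omega> (n + 1) \<noteq> 2" by blast
    obtain d where "n = N + d + 3"
      using n(1) by (metis le_Suc_ex add.commute add.left_commute)
    with n \<omega> [of "n + 1"] show ?thesis
      using two_zero [of d] two_one [of n] by auto
  qed (use two_two in blast)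
  then show ?thesis
  proof cases
    case two_zero
    have "map \<omega> [N + n..<N + n + (3 + 2)] = map \<omega> [N + n..<N + n + 3] @ [2, 0]"
      unfolding split two two_zero ..
    moreover have "map \<omega> [N + n..<N + n + 3] \<in> set (List.n_lists 3 [0, 1, 2])"
      using \<omega> by (intro letters) simp
    ultimately show ?thesis
      using unavoidable(1) by (intro window [of "N + n" "3 + 2"]) auto
  next
    case two_one
    have "map \<omega> [n..<n + (2 + 3)] = [2, 1] @ map \<omega> [n + 2..<n + 2 + 3]"
      unfolding split two two_one ..
    moreover have "map \<omega> [n + 2..<n + 2 + 3] \<in> set (List.n_lists 3 [0, 1, 2])"
      using \<omega> by (intro letters) simp
    ultimately show ?thesis
      using unavoidable(2) two_one(1) by (intro window [of n "2 + 3"]) auto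
  next
    case two_two
    \<comment> \<open>A 2 at a late position would be followed by 2s only.\<close>
    have "\<omega> n \<noteq> 2" if n: "n \<ge> N + 3" for n
    proof
      assume "\<omega> n = 2"
      have "\<omega> k = 2" if "n \<le> k" for k
        using that
      proof (induction rule: dec_induct)
        case (step k)
        then show ?case using two_two [of k] n by simp
      qed fact
      with not2 [of n] show False by blast
    qed
    then have \<omega>01: "\<omega> n \<in> {0, 1}" if "n \<ge> N + 3" for n
      using \<omega> [of n] that by blast
    show ?thesis
    proof (cases "\<exists>n. \<omega> (N + 3 + n + 4) = 1 \<and> \<omega> (N + 3 + n + 4 + 1) = 0")
      case True
      then obtain n where n: "\<omega> (N + 3 + n + 4) = 1" "\<omega> (N + 3 + n + 4 + 1) = 0" by blast
      let ?q = "N + 3 + n"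
      have "map \<omega> [?q..<?q + (4 + (2 + 4))] =
          map \<omega> [?q..<?q + 4] @ [1, 0] @ map \<omega> [?q + 4 + 2..<?q + 4 + 2 + 4]"
        unfolding split two n ..
      moreover have "map \<omega> [?q..<?q + 4] \<in> set (List.n_lists 4 [0, 1])"
        "map \<omega> [?q + 4 + 2..<?q + 4 + 2 + 4] \<in> set (List.n_lists 4 [0, 1])"
        by (rule letters; use \<omega>01 in simp)+
      ultimately show ?thesis
        using unavoidable(3) by (intro window [of ?q "4 + (2 + 4)"]) auto
    next
      case False
      obtain n where n: "n \<ge> N + 7" "\<omega> n \<noteq> 0"
        using not0 by blast
      have ones: "\<omega> k = 1" if "n \<le> k" for k
        using that
      proof (induction rule: dec_induct)
        case base
        then show ?case using \<omega>01 [of n] n by auto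
      next
        case (step k)
        obtain d where "k = N + 3 + d + 4"
          using step.hyps n(1) by (intro that [of "k - N - 7"]) simp
        with False step.IH \<omega>01 [of "Suc k"] show ?case by auto
      qed
      have "map \<omega> [n..<n + 5] = [1, 1, 1, 1, 1]"
        by (rule nth_equalityI) (auto simp: ones nth_Cons' simp del: upt_Suc)
      then show ?thesis
        using unavoidable(4) n(1) by (intro window [of n 5]) auto
    qed
  qed
qed

lemma start_word_occurs_infinitely_often:
  assumes "\<omega> \<in> X"
  obtains z where "z \<in> set start_words" "\<And>N. \<exists>p\<ge>N. map \<omega> [p..<p + length z] = z"
proof -
  have "\<exists>z\<in>set start_words. \<exists>\<^sub>F p in sequentially. map \<omega> [p..<p + length z] = z"
  proof (rule ccontr)
    assume "\<not> ?thesis"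
    then have "\<forall>\<^sub>F p in sequentially. \<forall>z\<in>set start_words. map \<omega> [p..<p + length z] \<noteq> z"
      by (intro eventually_ball_finite) (auto simp: frequently_def)
    then obtain N where "\<forall>p\<ge>N. \<forall>z\<in>set start_words. map \<omega> [p..<p + length z] \<noteq> z"
      unfolding eventually_sequentially by blast
    with start_word_occurs [OF assms, of N] show False by blast
  qed
  then show ?thesis
    using that unfolding frequently_sequentially by blast
qed

section \<open>The regular words\<close>

lemma C_regular_if_in_X:
  assumes "\<omega> \<in> X"
  shows "C_regular \<omega>"
proof -
  have \<omega>: "\<omega> k \<in> {0, 1, 2}" and not0: "\<exists>k\<ge>n. \<omega> k \<noteq> 0" and not2: "\<exists>k\<ge>n. \<omega> k \<noteq> 2" for k n
    using assms by (auto simp: X_iff words_def)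
  have tail: "\<exists>m'\<ge>m. \<omega> (p + m') \<noteq> loop_letter r" for p m r
  proof -
    have "\<exists>k\<ge>p + m. \<omega> k \<noteq> loop_letter r"
      unfolding loop_letter_def using not0 [of "p + m"] not2 [of "p + m"] by (cases "even r") simp_all
    then obtain k where "k \<ge> p + m" "\<omega> k \<noteq> loop_letter r"
      by blast
    then show ?thesis
      by (intro exI [of _ "k - p"]) simp
  qed
  obtain z where z: "z \<in> set start_words" and occ: "\<And>N. \<exists>p\<ge>N. map \<omega> [p..<p + length z] = z"
    using start_word_occurs_infinitely_often [OF assms] by blast
  have "list_all (\<lambda>a. a = 0 \<or> a = 1 \<or> a = 2) z"
    using start_words_two_level z by blast
  then have "set z \<subseteq> {0, 1, 2}"
    unfolding list_all_iff by blast
  obtain \<sigma> where \<sigma>: "\<sigma> \<in> set states" "two_level z \<sigma>"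
    using start_words_two_level z by blast
  obtain \<alpha> \<beta> where fits: "fits_state \<sigma> \<alpha> \<beta>" and sup: "row_supports (word_prod z) \<alpha> \<beta>"
    and "\<forall>j. \<alpha> $ j \<in> {0, 1} \<and> \<beta> $ j \<in> {0, 1} \<and> (\<alpha> $ j = 0 \<or> \<beta> $ j = 0)"
    using two_level_row_supports [OF \<sigma>(2) \<open>set z \<subseteq> {0, 1, 2}\<close>] by (elim exE conjE)
  then have ind: "\<alpha> $ j \<in> {0, 1}" "\<beta> $ j \<in> {0, 1}" and disjoint: "\<alpha> $ j = 0 \<or> \<beta> $ j = 0" for j
    by simp_all
  have nonneg: "0 \<le> \<alpha> $ j" "0 \<le> \<beta> $ j" for j
    using ind [of j] by auto
  have block: "\<exists>L. \<forall>p. map \<omega> [p..<p + length z] = z \<longrightarrow>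
      (\<exists>q. \<forall>n\<ge>q. P ** mat_prod (\<lambda>k. A (\<omega> k)) p n \<in> H1 \<inter> H2 L \<inter> H3 (1 / 2))"
    if P: "nonneg_mat P" for P
  proof -
    have "nonneg_mat (P ** word_prod z)" "row_supports (P ** word_prod z) \<alpha> \<beta>"
      by (intro nonneg_mat_mult row_supports_left_mult P nonneg_word_prod sup nonneg)+
    from good_block [OF this \<sigma>(1) fits ind disjoint] obtain L where
      L: "\<forall>a. (\<forall>m. a m \<in> {0, 1, 2}) \<longrightarrow> (\<forall>m r. \<exists>m'\<ge>m. a m' \<noteq> loop_letter r) \<longrightarrow>
        (\<exists>q. \<forall>m\<ge>q. P ** word_prod z ** word_prod (map a [0..<m]) \<in> H1 \<inter> H2 L \<inter> H3 (1 / 2))" ..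
    have "\<exists>q. \<forall>n\<ge>q. P ** mat_prod (\<lambda>k. A (\<omega> k)) p n \<in> H1 \<inter> H2 L \<inter> H3 (1 / 2)"
      if p: "map \<omega> [p..<p + length z] = z" for p
    proof -
      define p' where "p' = p + length z"
      have "\<forall>m. \<omega> (p' + m) \<in> {0, 1, 2}" "\<forall>m r. \<exists>m'\<ge>m. \<omega> (p' + m') \<noteq> loop_letter r"
        by (intro allI \<omega> tail)+
      from L [rule_format, OF this [rule_format]] obtain q where
        q: "\<forall>m\<ge>q. P ** word_prod z ** word_prod (map (\<lambda>m. \<omega> (p' + m)) [0..<m])
          \<in> H1 \<inter> H2 L \<inter> H3 (1 / 2)" ..
      have "P ** mat_prod (\<lambda>k. A (\<omega> k)) p n \<in> H1 \<inter> H2 L \<inter> H3 (1 / 2)" if n: "n \<ge> p' + q" for n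
      proof -
        have "map \<omega> [p..<n] = map \<omega> [p..<p'] @ map \<omega> [p'..<n]"
          using n upt_add_eq_append [of p p' "n - p'"] by (simp add: p'_def)
        also have "map \<omega> [p'..<n] = map (\<lambda>m. \<omega> (p' + m)) [0..<n - p']"
          by (rule nth_equalityI) (auto simp del: upt_Suc)
        finally show ?thesis
          using q [rule_format, of "n - p'"] n p
          by (simp add: mat_prod_eq_word_prod word_prod_append matrix_mul_assoc p'_def del: Int_iff)
      qed
      then show ?thesis by blast
    qed
    then show ?thesis by blast
  qed
  \<comment> \<open>The block from 0 is led by the matrix \<open>P\<close> of the letters before \<open>z\<close>; later blocks begin with \<open>z\<close>.\<close>
  obtain p0 where p0: "map \<omega> [p0..<p0 + length z] = z"
    using occ by blast
  define P where "P = word_prod (map \<omega> [0..<p0])"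
  have "nonneg_mat P"
    by (simp add: P_def nonneg_word_prod)
  from block [OF this] obtain L0 where "\<forall>p. map \<omega> [p..<p + length z] = z \<longrightarrow>
      (\<exists>q. \<forall>n\<ge>q. P ** mat_prod (\<lambda>k. A (\<omega> k)) p n \<in> H1 \<inter> H2 L0 \<inter> H3 (1 / 2))" ..
  with p0 obtain q0 where
    L0: "\<forall>n\<ge>q0. P ** mat_prod (\<lambda>k. A (\<omega> k)) p0 n \<in> H1 \<inter> H2 L0 \<inter> H3 (1 / 2)"
    by blast
  have "nonneg_mat (mat 1 :: real ^ 7 ^ 7)"
    by (simp add: nonneg_mat_def mat_1_nth)
  from block [OF this] obtain L1 where L1: "\<forall>p. map \<omega> [p..<p + length z] = z \<longrightarrow>
      (\<exists>q. \<forall>n\<ge>q. mat_prod (\<lambda>k. A (\<omega> k)) p n \<in> H1 \<inter> H2 L1 \<inter> H3 (1 / 2))"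
    unfolding matrix_mul_lid ..
  show ?thesis
    unfolding C_regular_def
  proof (rule condition_C_I [where lam = "1 / 2"])
    have "mat_prod (\<lambda>k. A (\<omega> k)) 0 n = P ** mat_prod (\<lambda>k. A (\<omega> k)) p0 n" if "n \<ge> p0" for n
    proof -
      have "[0..<n] = [0..<p0] @ [p0..<n]"
        using that upt_add_eq_append [of 0 p0 "n - p0"] by simp
      then show ?thesis
        by (simp only: mat_prod_eq_word_prod P_def map_append word_prod_append)
    qed
    then show "\<exists>q. \<forall>n\<ge>q. mat_prod (\<lambda>k. A (\<omega> k)) 0 n \<in> H1 \<inter> H2 L0 \<inter> H3 (1 / 2)"
      using L0 by (intro exI [of _ "max p0 q0"]) (simp del: Int_iff)
    show "\<exists>p\<ge>N. \<exists>q. \<forall>n\<ge>q. mat_prod (\<lambda>k. A (\<omega> k)) p n \<in> H1 \<inter> H2 L1 \<inter> H3 (1 / 2)" for N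
      using occ [of N] L1 by blast
  qed (simp_all add: nonneg_A)
qed

text \<open>
  A basic open set restricts finitely many letters; all the others can be made 1.
\<close>

lemma closure_of_X: "word_topology closure_of X = topspace word_topology"
proof (intro equalityI closure_of_subset_topspace subsetI)
  fix \<omega> assume \<omega>: "\<omega> \<in> topspace word_topology"
  show "\<omega> \<in> word_topology closure_of X"
    unfolding in_closure_of
  proof (intro conjI allI impI \<omega>)
    fix T assume T: "\<omega> \<in> T \<and> openin word_topology T"
    then obtain U where fin: "finite {i. U i \<noteq> {0, 1, 2 :: nat}}" and \<omega>U: "\<omega> \<in> Pi\<^sub>E UNIV U"
      and UT: "Pi\<^sub>E UNIV U \<subseteq> T"
      unfolding word_topology_def openin_product_topology_alt by auto
    define \<eta> where "\<eta> k = (if U k \<noteq> {0, 1, 2} then \<omega> k else 1)" for k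
    have "\<eta> \<in> Pi\<^sub>E UNIV U"
      using \<omega>U by (auto simp: \<eta>_def PiE_UNIV_domain Pi_iff)
    moreover have "\<eta> \<in> X"
    proof -
      have "\<exists>k\<ge>n. \<eta> k = 1" for n
      proof -
        obtain k where "k \<ge> n" "U k = {0, 1, 2}"
          using fin unfolding finite_nat_set_iff_bounded_le by (metis (mono_tags) Suc_n_not_le_n le_Suc_eq mem_Collect_eq nat_le_linear order_trans)
        then show ?thesis by (auto simp: \<eta>_def)
      qed
      moreover have "\<eta> \<in> words"
        using \<omega> by (auto simp: topspace_word_topology words_def \<eta>_def)
      ultimately show ?thesis
        unfolding X_iff by (metis one_neq_zero numeral_eq_one_iff semiring_norm(85))
    qed
    ultimately show "\<exists>y. y \<in> X \<and> y \<in> T"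
      using UT by blast
  qed
qed

theorem proposition9p1:
  shows "{\<omega> \<in> words. C_regular \<omega>} = X \<and>
         word_topology closure_of X = topspace word_topology"
proof
  show "{\<omega> \<in> words. C_regular \<omega>} = X"
  proof (intro equalityI subsetI)
    fix \<omega> assume "\<omega> \<in> {\<omega> \<in> words. C_regular \<omega>}"
    then show "\<omega> \<in> X"
      using not_C_regular_if_eventually_const unfolding X_iff by blast
  next
    fix \<omega> assume "\<omega> \<in> X"
    then show "\<omega> \<in> {\<omega> \<in> words. C_regular \<omega>}"
      using C_regular_if_in_X by (simp add: X_iff)
  qed
qed (rule closure_of_X)

end
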